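(* Let $K\subset\mathbb{R}^2$ be a compact convex set of area $F$ with boundary of class $\mathcal{C}^2$, having the origin as an interior point. Then $$(k^2-1)\int_{P\notin K}\bigl(H_k(\omega_1)+H_k(\omega_2)\bigr)\,dP=\pi F$$ for each odd integer $k\ge3$, where $$H_k(x)=\frac{1}{2(k^2-1)}\bigl(f_k(x)+2(\sin x-x)\bigr),$$ $$f_k(x)=-2\sin x+\frac{k+1}{k-1}\sin((k-1)x)-\frac{k-1}{k+1}\sin((k+1)x).$$
   Context: $dP$ is the area element of the plane and $O$ is the origin. Direction of a line through a point $P\neq O$: let $\vec u$ be the unit vector orthogonal to $\overrightarrow{OP}$ such that the basis $(\vec u,\overrightarrow{OP})$ is positively oriented; for a line $G$ through $P$ (other than the one directed by $\vec u$) with unit director vector $\vec v$ chosen so that $(\vec u,\vec v)$ is positively oriented, the direction $\alpha(G)\in(0,\pi)$ is defined by $\cos\alpha=\vec u\cdot\vec v$. For $P\notin K$ the two support lines of $K$ through $P$ have directions $\alpha,\beta$ with $0<\alpha<\pi/2<\beta<\pi$. One sets $\omega_1=\omega_1(P)=\pi/2-\alpha$ and $\omega_2=\omega_2(P)=\beta-\pi/2$; thus $\omega_1+\omega_2=\beta-\alpha$ is the visual angle of $K$ from $P$, split into $\omega_1$ and $\omega_2$ by the line $OP$.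
   Formalization: Support-line directions are angles in (-π/2, 3π/2) to the director vector pointing away from K, instead of in (0,π), since 0<α<π/2<β<π can fail for P near the boundary; ω1, ω2 are then always the parts of the visual angle cut by OP. *)

theory Defs
  imports "HOL-Analysis.Analysis"
begin

text \<open>A subset of the plane is a curve of class C2 if near each of its points it is the
  homeomorphic image of an open interval under a regular C2 parametrization.\<close>

definition C2_curve :: "(real^2) set \<Rightarrow> bool" where
  "C2_curve S \<longleftrightarrow>
     (\<forall>p\<in>S. \<exists>U a b \<gamma> \<gamma>' \<delta>.
        open U \<and> p \<in> U \<and> homeomorphism {a<..<b::real} (S \<inter> U) \<gamma> \<delta> \<and>
        (\<forall>t\<in>{a<..<b}. (\<gamma> has_vector_derivative \<gamma>' t) (at t) \<and> \<gamma>' t \<noteq> 0) \<and>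
        \<gamma>' C1_differentiable_on {a<..<b})"

definition support_line :: "(real^2) set \<Rightarrow> (real^2) set \<Rightarrow> bool" where
  "support_line K G \<longleftrightarrow>
     (\<exists>n c. n \<noteq> 0 \<and> G = {x. n \<bullet> x = c} \<and> K \<subseteq> {x. n \<bullet> x \<le> c} \<and> G \<inter> K \<noteq> {})"

text \<open>The basis \<open>(x, y)\<close> of the plane is positively oriented iff \<open>area_form x y > 0\<close>.\<close>

definition area_form :: "real^2 \<Rightarrow> real^2 \<Rightarrow> real" where
  "area_form x y = det (vector [x, y] :: real^2^2)"

definition transverse_unit :: "real^2 \<Rightarrow> real^2" where
  "transverse_unit P = (THE u. norm u = 1 \<and> orthogonal u P \<and> area_form u P > 0)"

text \<open>For a support line \<open>G\<close> of \<open>K\<close> through a point \<open>P\<close> outside \<open>K\<close>, the unit director vector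
  is the one such that the ray from \<open>P\<close> in the opposite direction meets \<open>K\<close>, and the direction
  of \<open>G\<close> is the oriented angle, in \<open>(-\<pi>/2, 3\<pi>/2)\<close>, from \<open>u = transverse_unit P\<close> to it.
  If this angle lies in \<open>(0, \<pi>)\<close>, then it is the \<open>\<alpha> \<in> (0, \<pi>)\<close> with \<open>cos \<alpha> = u \<bullet> v\<close> for the unit
  director vector \<open>v\<close> of \<open>G\<close> with \<open>(u, v)\<close> positively oriented, see \<open>direction_eq_arccos\<close>
  below. The larger range matters for \<open>P\<close> close to the boundary of \<open>K\<close>: if the boundary of \<open>K\<close>
  is smooth and \<open>K\<close> is not a disc centred at the origin, there are points \<open>P\<close> at which one of the two parts into which
  the line \<open>OP\<close> splits the visual angle exceeds \<open>\<pi>/2\<close>.\<close>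

definition director :: "(real^2) set \<Rightarrow> real^2 \<Rightarrow> (real^2) set \<Rightarrow> real^2" where
  "director K P G =
     (THE v. norm v = 1 \<and> G = range (\<lambda>t. P + t *\<^sub>R v) \<and> (\<exists>t>0. P - t *\<^sub>R v \<in> K))"

definition direction :: "(real^2) set \<Rightarrow> real^2 \<Rightarrow> (real^2) set \<Rightarrow> real" where
  "direction K P G =
     (THE a. - pi / 2 < a \<and> a < 3 * pi / 2 \<and>
        cos a = transverse_unit P \<bullet> director K P G \<and>
        sin a = area_form (transverse_unit P) (director K P G))"

definition support_directions :: "(real^2) set \<Rightarrow> real^2 \<Rightarrow> real set" where
  "support_directions K P = direction K P ` {G. support_line K G \<and> P \<in> G}"

definition omega1 :: "(real^2) set \<Rightarrow> real^2 \<Rightarrow> real" where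
  "omega1 K P = pi / 2 - (THE a. a \<in> support_directions K P \<and> a < pi / 2)"

definition omega2 :: "(real^2) set \<Rightarrow> real^2 \<Rightarrow> real" where
  "omega2 K P = (THE b. b \<in> support_directions K P \<and> pi / 2 < b) - pi / 2"

definition fk :: "int \<Rightarrow> real \<Rightarrow> real" where
  "fk k x = - 2 * sin x
     + (real_of_int k + 1) / (real_of_int k - 1) * sin ((real_of_int k - 1) * x)
     - (real_of_int k - 1) / (real_of_int k + 1) * sin ((real_of_int k + 1) * x)"

definition Hk :: "int \<Rightarrow> real \<Rightarrow> real" where
  "Hk k x = 1 / (2 * ((real_of_int k)\<^sup>2 - 1)) * (fk k x + 2 * (sin x - x))"

lemma area_form_alt: "area_form x y = x $ 1 * y $ 2 - x $ 2 * y $ 1"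
  by (simp add: area_form_def det_2 vector_2)

lemma transverse_unit_eq:
  assumes "P \<noteq> 0"
  shows "transverse_unit P = (1 / norm P) *\<^sub>R vector [P $ 2, - P $ 1]"
  unfolding transverse_unit_def
proof (rule the_equality)
  let ?w = "(1 / norm P) *\<^sub>R vector [P $ 2, - P $ 1] :: real^2"
  have nP: "(norm P)\<^sup>2 = (P $ 1)\<^sup>2 + (P $ 2)\<^sup>2" for P :: "real^2"
    by (simp add: norm_vec_def L2_set_def sum_2)
  have pos: "norm P > 0" using assms by simp
  have "(norm ?w)\<^sup>2 = 1\<^sup>2"
    using pos by (simp only: nP) (simp add: vector_2 nP field_simps flip: nP)
  then have "norm ?w = 1" by (metis norm_ge_zero power2_eq_imp_eq zero_le_one)
  moreover have "orthogonal ?w P"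
    by (simp add: orthogonal_def inner_vec_def sum_2 vector_2)
  moreover have "area_form ?w P = norm P"
    using pos nP[of P] by (simp add: area_form_alt vector_2 field_simps power2_eq_square)
  ultimately show "norm ?w = 1 \<and> orthogonal ?w P \<and> area_form ?w P > 0" using pos by simp
next
  fix u :: "real^2"
  assume u: "norm u = 1 \<and> orthogonal u P \<and> area_form u P > 0"
  have n2: "(norm x)\<^sup>2 = (x $ 1)\<^sup>2 + (x $ 2)\<^sup>2" for x :: "real^2"
    by (simp add: norm_vec_def L2_set_def sum_2)
  have 1: "(u $ 1)\<^sup>2 + (u $ 2)\<^sup>2 = 1" using u n2[of u] by simp
  have 2: "u $ 1 * P $ 1 + u $ 2 * P $ 2 = 0"
    using u by (simp add: orthogonal_def inner_vec_def sum_2)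
  have "(area_form u P)\<^sup>2 = (norm P)\<^sup>2"
  proof -
    have "(area_form u P)\<^sup>2 = (area_form u P)\<^sup>2 + (u $ 1 * P $ 1 + u $ 2 * P $ 2)\<^sup>2"
      using 2 by simp
    also have "\<dots> = ((u $ 1)\<^sup>2 + (u $ 2)\<^sup>2) * ((P $ 1)\<^sup>2 + (P $ 2)\<^sup>2)"
      unfolding area_form_alt by algebra
    finally show ?thesis by (simp add: 1 n2)
  qed
  then have 3: "u $ 1 * P $ 2 - u $ 2 * P $ 1 = norm P"
    using u by (metis area_form_alt less_imp_le norm_ge_zero power2_eq_imp_eq)
  have "norm P * u $ 1 = P $ 2" "norm P * u $ 2 = - P $ 1"
    using 1 2 unfolding 3[symmetric] by algebra+
  then show "u = (1 / norm P) *\<^sub>R vector [P $ 2, - P $ 1]"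
    using assms by (simp add: vec_eq_iff forall_2 vector_2 field_simps)
qed

lemma direction_eq_arccos:
  assumes "norm (transverse_unit P) = 1" "norm (director K P G) = 1"
    and pos: "area_form (transverse_unit P) (director K P G) > 0"
  shows "direction K P G = arccos (transverse_unit P \<bullet> director K P G)"
    and "0 < direction K P G" "direction K P G < pi"
proof -
  define u v where "u = transverse_unit P" and "v = director K P G"
  have n2: "(norm x)\<^sup>2 = (x $ 1)\<^sup>2 + (x $ 2)\<^sup>2" for x :: "real^2"
    by (simp add: norm_vec_def L2_set_def sum_2)
  have uv: "(u $ 1)\<^sup>2 + (u $ 2)\<^sup>2 = 1" "(v $ 1)\<^sup>2 + (v $ 2)\<^sup>2 = 1"
    using assms n2[of u] n2[of v] by (auto simp: u_def v_def)
  have sq: "(area_form u v)\<^sup>2 + (u \<bullet> v)\<^sup>2 = 1"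
    using uv unfolding area_form_alt inner_vec_def sum_2 inner_real_def by algebra
  have p: "area_form u v > 0" using pos by (simp add: u_def v_def)
  then have "(u \<bullet> v)\<^sup>2 < 1" using sq zero_less_power[of "area_form u v" 2] by linarith
  then have c: "- 1 < u \<bullet> v" "u \<bullet> v < 1"
    by (auto simp: abs_square_less_1)
  have s: "sin (arccos (u \<bullet> v)) = area_form u v"
    using c p sq by (simp add: sin_arccos real_sqrt_unique)
  have b: "0 < arccos (u \<bullet> v)" "arccos (u \<bullet> v) < pi"
    using arccos_lt_bounded[of "u \<bullet> v"] c by auto
  show eq: "direction K P G = arccos (transverse_unit P \<bullet> director K P G)"
    unfolding direction_def u_def[symmetric] v_def[symmetric]
  proof (rule the_equality)
    show "- pi / 2 < arccos (u \<bullet> v) \<and> arccos (u \<bullet> v) < 3 * pi / 2 \<and>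
        cos (arccos (u \<bullet> v)) = u \<bullet> v \<and> sin (arccos (u \<bullet> v)) = area_form u v"
      using b c s pi_gt_zero by (auto intro: cos_arccos)
  next
    fix a assume a: "- pi / 2 < a \<and> a < 3 * pi / 2 \<and> cos a = u \<bullet> v \<and> sin a = area_form u v"
    have "0 < a"
    proof (rule ccontr)
      assume "\<not> 0 < a"
      then have "0 \<le> sin (- a)" using a by (intro sin_ge_zero) auto
      with a p show False by simp
    qed
    moreover have "a < pi"
    proof (rule ccontr)
      assume "\<not> a < pi"
      then have "0 \<le> sin (a - pi)" using a by (intro sin_ge_zero) auto
      with a p show False by simp
    qed
    ultimately show "a = arccos (u \<bullet> v)" using a arccos_cos[of a] by simp
  qed
  show "0 < direction K P G" "direction K P G < pi"
    using b unfolding eq u_def v_def by auto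
qed

end

theory Submission
  imports Defs "HOL-Probability.Sinc_Integral"
begin

text \<open>
  Write \<open>k = 2m + 1\<close> and \<open>G = (k\<^sup>2 - 1) H\<^sub>k\<close>. Two properties of \<open>G\<close> carry the proof. Its
  derivative is \<open>G'(x) = sin\<^sup>2 x Q(x)\<close>, where \<open>Q\<close> is a linear combination of the functions
  \<open>cos (2 j x)\<close> with \<open>j \<ge> 1\<close>, so that \<open>Q\<close> has mean zero over \<open>(0, \<pi>)\<close>. And
  \<open>G (\<pi> - x) = - \<pi> - G x\<close>, so that \<open>G \<pi> = - \<pi>\<close>.

  Let \<open>n(\<phi>)\<close> be the unit vector with polar angle \<open>\<phi>\<close> and \<open>h(\<phi>)\<close> the value of the support
  function of \<open>K\<close> at \<open>n(\<phi>)\<close>. For a point \<open>P \<noteq> 0\<close> let \<open>\<Phi>(P)\<close> be the integral of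
  \<open>G'(x(P, \<phi>))\<close> over all \<open>\<phi>\<close> in a period with \<open>0 < P \<bullet> n(\<phi>) \<le> h(\<phi>)\<close>, where \<open>x(P, \<phi>)\<close> is the angle
  between the ray \<open>OP\<close> and the line through \<open>P\<close> with normal \<open>n(\<phi>)\<close>. The second inequality says
  that this line does not separate \<open>P\<close> from \<open>K\<close>.

  If \<open>P\<close> is in \<open>K\<close>, no line is left out, and \<open>\<Phi>(P) = G \<pi> - G 0 = - \<pi>\<close>
  (\<open>angular_integral_inside\<close>). If \<open>P\<close> is outside \<open>K\<close>, the normals left out form an arc bounded by
  the normals of the two support lines (\<open>visible_arc\<close>), and integrating \<open>G'\<close> over the two
  remaining pieces gives \<open>\<Phi>(P) = G \<omega>\<^sub>1 + G \<omega>\<^sub>2\<close> (\<open>angular_integral_outside\<close>). The theorem is thus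
  the statement that \<open>\<Phi>\<close> has integral zero over the plane: the integral over the complement of
  \<open>K\<close> is then \<open>\<pi>\<close> times the area of \<open>K\<close>.

  For this, integrate over \<open>P\<close> first, with \<open>\<phi>\<close> fixed (\<open>integral_plane_kernel\<close>). The domain is
  the strip \<open>0 < t \<le> h(\<phi>)\<close>, with \<open>t = P \<bullet> n(\<phi>)\<close>. On a line of constant \<open>t\<close> the position is
  \<open>s = t cot x\<close>, so \<open>G'(x) ds = - t Q(x) dx\<close> with \<open>x\<close> running through \<open>(0, \<pi>)\<close>, and the integral
  vanishes. Fubini's theorem applies because \<open>\<bar>G'(x)\<bar>\<close> is at most a constant times \<open>sin\<^sup>2 x\<close>.
\<close>

section \<open>The function \<open>H\<^sub>k\<close> and its derivative\<close>

definition cosine_sum :: "nat \<Rightarrow> real \<Rightarrow> real" where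
  "cosine_sum m x = (\<Sum>j=1..m. 4 * real j * cos (2 * real j * x))"

definition sine_sum :: "nat \<Rightarrow> real \<Rightarrow> real" where
  "sine_sum m x = (\<Sum>j=1..m. 2 * sin (2 * real j * x))"

text \<open>For \<open>k = 2m + 1\<close> this is \<open>(k\<^sup>2 - 1) H\<^sub>k\<close>. Odd \<open>k\<close> is what makes the frequencies
  \<open>k - 1\<close> and \<open>k + 1\<close> even, and hence gives the symmetry under \<open>x \<mapsto> \<pi> - x\<close> used below.\<close>

definition scaled_Hk :: "nat \<Rightarrow> real \<Rightarrow> real" where
  "scaled_Hk m x = ((real_of_int (2 * int m + 1))\<^sup>2 - 1) * Hk (2 * int m + 1) x"

lemma scaled_Hk_eq:
  assumes "m \<ge> 1"
  shows "scaled_Hk m x = (real m + 1) / (2 * real m) * sin (2 * real m * x)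
     - real m / (2 * (real m + 1)) * sin (2 * (real m + 1) * x) - x"
proof -
  have c: "(2 * real m + 1)\<^sup>2 - 1 \<noteq> 0" using assms by (simp add: power2_eq_square algebra_simps add_nonneg_eq_0_iff)
  have e: "scaled_Hk m x = 1 / 2 * (fk (2 * int m + 1) x + 2 * (sin x - x))"
    unfolding scaled_Hk_def Hk_def using c by (simp add: divide_simps)
  have f: "fk (2 * int m + 1) x = - 2 * sin x + (real m + 1) / real m * sin (2 * real m * x)
     - real m / (real m + 1) * sin (2 * (real m + 1) * x)"
  proof -
    have q: "(real_of_int (2 * int m + 1) + 1) / (real_of_int (2 * int m + 1) - 1) = (real m + 1) / real m"
      "(real_of_int (2 * int m + 1) - 1) / (real_of_int (2 * int m + 1) + 1) = real m / (real m + 1)"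
      using assms by (simp_all add: divide_simps)
    have a: "(real_of_int (2 * int m + 1) - 1) * x = 2 * real m * x"
      "(real_of_int (2 * int m + 1) + 1) * x = 2 * (real m + 1) * x"
      by (simp_all add: algebra_simps)
    show ?thesis unfolding fk_def q a ..
  qed
  define A B where "A = (real m + 1) / real m" and "B = real m / (real m + 1)"
  have AB: "(real m + 1) / (2 * real m) = A / 2" "real m / (2 * (real m + 1)) = B / 2"
    by (simp_all add: A_def B_def)
  show ?thesis unfolding e f AB A_def[symmetric] B_def[symmetric] by (simp add: algebra_simps)
qed

text \<open>The left-hand side is the derivative of \<open>scaled_Hk m\<close>. Passing from \<open>m\<close> to \<open>m + 1\<close> adds
  \<open>2 (m + 1) cos (2 (m + 1) x) (1 - cos (2 x))\<close>, and \<open>1 - cos (2 x) = 2 sin\<^sup>2 x\<close>, so that a factor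
  \<open>sin\<^sup>2 x\<close> splits off. This factor gives all the decay at infinity that the integrals need.\<close>

lemma sin_sq_cosine_sum:
  "(real m + 1) * cos (2 * real m * x) - real m * cos (2 * (real m + 1) * x) - 1
     = (sin x)\<^sup>2 * cosine_sum m x"
proof (induction m)
  case 0
  then show ?case by (simp add: cosine_sum_def)
next
  case (Suc m)
  define y where "y = 2 * (real m + 1) * x"
  have c: "cos (2 * real m * x) = cos (y - 2 * x)" "cos (2 * (real m + 2) * x) = cos (y + 2 * x)"
    by (simp_all add: y_def algebra_simps)
  have "cosine_sum (Suc m) x = cosine_sum m x + 4 * (real m + 1) * cos y"
    by (simp add: cosine_sum_def y_def algebra_simps)
  then have "(sin x)\<^sup>2 * cosine_sum (Suc m) x = (real m + 1) * cos (y - 2 * x) - real m * cos y - 1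
      + 4 * (real m + 1) * cos y * (sin x)\<^sup>2"
    using Suc by (simp only: c(1) y_def[symmetric]) (simp add: algebra_simps)
  also have "4 * (sin x)\<^sup>2 = 2 - 2 * cos (2 * x)" by (simp add: cos_double_sin)
  then have "4 * (real m + 1) * cos y * (sin x)\<^sup>2 = (real m + 1) * (2 * cos y - 2 * cos y * cos (2 * x))"
    by algebra
  also have "2 * cos y * cos (2 * x) = cos (y - 2 * x) + cos (y + 2 * x)"
    by (simp add: cos_diff cos_add)
  finally have "(sin x)\<^sup>2 * cosine_sum (Suc m) x = (real m + 2) * cos y - (real m + 1) * cos (y + 2 * x) - 1"
    by (simp add: algebra_simps)
  then show ?case by (simp add: c[symmetric] y_def algebra_simps)
qed

lemma sine_sum_deriv [derivative_intros]:
  "(sine_sum m has_real_derivative cosine_sum m x) (at x)"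
  unfolding sine_sum_def[abs_def] cosine_sum_def
  by (auto intro!: derivative_eq_intros sum.cong)

lemma sine_sum_0 [simp]: "sine_sum m 0 = 0"
  by (simp add: sine_sum_def)

lemma sine_sum_pi [simp]: "sine_sum m pi = 0"
  unfolding sine_sum_def
  by (rule sum.neutral) (metis mult.assoc mult_zero_right sin_npi of_nat_mult of_nat_numeral)

lemma scaled_Hk_deriv:
  assumes "m \<ge> 1"
  shows "(scaled_Hk m has_real_derivative (sin x)\<^sup>2 * cosine_sum m x) (at x)"
proof -
  have "(scaled_Hk m has_real_derivative
     (real m + 1) * cos (2 * real m * x) - real m * cos (2 * (real m + 1) * x) - 1) (at x)"
    unfolding scaled_Hk_eq[OF assms, abs_def]
    using assms by (auto intro!: derivative_eq_intros)
  then show ?thesis by (simp only: sin_sq_cosine_sum)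
qed

lemma scaled_Hk_0: "m \<ge> 1 \<Longrightarrow> scaled_Hk m 0 = 0"
  by (simp add: scaled_Hk_eq)

text \<open>The two sine terms have even frequencies and change sign under the reflection; only the linear
  term contributes the constant. At \<open>x = 0\<close> this yields the value \<open>-\<pi>\<close> at \<open>\<pi>\<close>, which is
  the origin of the factor \<open>\<pi>\<close> in the theorem.\<close>

lemma scaled_Hk_reflect:
  assumes "m \<ge> 1"
  shows "scaled_Hk m (pi - x) = - pi - scaled_Hk m x"
proof -
  have "sin (2 * real j * (pi - x)) = - sin (2 * real j * x)" for j
  proof -
    have "2 * real j * (pi - x) = - (2 * real j * x) + real j * (2 * pi)"
      by (simp add: algebra_simps)
    moreover have "sin (real j * (2 * pi)) = 0" "cos (real j * (2 * pi)) = 1"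
      using sin_npi2[of "2 * j"] cos_2npi[of j] by (simp_all add: mult_ac)
    ultimately show ?thesis by (simp only: sin_add) simp
  qed
  from this[of m] this[of "Suc m"]
  have "sin (2 * real m * (pi - x)) = - sin (2 * real m * x)"
    "sin (2 * (real m + 1) * (pi - x)) = - sin (2 * (real m + 1) * x)"
    by (simp_all only: of_nat_Suc add.commute)
  then show ?thesis unfolding scaled_Hk_eq[OF assms] by simp
qed

lemma cosine_sum_bound: "\<bar>cosine_sum m x\<bar> \<le> 4 * (real m)\<^sup>2"
proof -
  have "\<bar>cosine_sum m x\<bar> \<le> (\<Sum>j=1..m. \<bar>4 * real j * cos (2 * real j * x)\<bar>)"
    unfolding cosine_sum_def by (rule sum_abs)
  also have "\<dots> \<le> (\<Sum>j=1..m. 4 * real m)"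
    using abs_cos_le_one by (intro sum_mono) (auto simp: abs_mult intro!: mult_mono[of _ _ _ 1, simplified] order_trans[OF mult_left_le])
  finally show ?thesis by (simp add: power2_eq_square)
qed

lemma continuous_cosine_sum [continuous_intros]:
  fixes S :: "real set"
  shows "continuous_on S g \<Longrightarrow> continuous_on S (\<lambda>x. cosine_sum m (g x))"
  unfolding cosine_sum_def
  by (intro continuous_on_sum continuous_on_mult continuous_on_const continuous_on_cos)

lemma measurable_cosine_sum [measurable]: "cosine_sum m \<in> borel_measurable borel"
  by (intro borel_measurable_continuous_onI continuous_intros)

lemma cauchy_density:
  shows "integrable lborel (\<lambda>x::real. 1 / (1 + x\<^sup>2))" "(\<integral>\<^sup>+x. ennreal (1 / (1 + x\<^sup>2)) \<partial>lborel) = ennreal pi"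
proof -
  have UN: "einterval (-\<infinity>) \<infinity> = UNIV" by (auto simp: einterval_def)
  show *: "integrable lborel (\<lambda>x::real. 1 / (1 + x\<^sup>2))"
    using integrable_inverse_1_plus_square by (simp add: UN set_integrable_def inverse_eq_divide)
  have "integral\<^sup>L lborel (\<lambda>x::real. 1 / (1 + x\<^sup>2)) = pi"
    using LBINT_inverse_1_plus_square
    by (simp add: UN interval_lebesgue_integral_def set_lebesgue_integral_def inverse_eq_divide)
  then show "(\<integral>\<^sup>+x. ennreal (1 / (1 + x\<^sup>2)) \<partial>lborel) = ennreal pi"
    using nn_integral_eq_integral[OF *] by simp
qed

text \<open>
  With \<open>y = \<pi>/2 - arctan x\<close>, that is \<open>x = cot y\<close>, the integral becomes that of \<open>cosine_sum m\<close>
  over \<open>(0, \<pi>)\<close>, where each of its terms has mean zero.\<close>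

lemma integral_cauchy_cosine_sum:
  "(\<integral>x. 1 / (1 + x\<^sup>2) * cosine_sum m (pi / 2 - arctan x) \<partial>lborel) = 0"
  (is "integral\<^sup>L lborel ?f = 0")
proof -
  have UN: "einterval (-\<infinity>) \<infinity> = UNIV" by (auto simp: einterval_def)
  have i: "integrable lborel ?f"
  proof (rule Bochner_Integration.integrable_bound)
    show "integrable lborel (\<lambda>x::real. (1 / (1 + x\<^sup>2)) * (4 * (real m)\<^sup>2))"
      by (intro integrable_mult_left cauchy_density)
    show "AE x in lborel. norm (?f x) \<le> norm (1 / (1 + x\<^sup>2) * (4 * (real m)\<^sup>2))"
      using cosine_sum_bound by (auto simp: abs_mult simp del: times_divide_eq_left intro!: mult_left_mono)
  qed measurable
  have lim: "((sine_sum m \<circ> (\<lambda>x. pi / 2 - arctan x)) \<longlongrightarrow> sine_sum m (pi / 2 - l)) F"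
    if "(arctan \<longlongrightarrow> l) F" for l F
    unfolding o_def using that
    by (intro isCont_tendsto_compose[OF DERIV_isCont[OF sine_sum_deriv]] tendsto_intros)
  have "(LBINT x=-\<infinity>..\<infinity>. ?f x) = - sine_sum m (pi / 2 - pi / 2) - (- sine_sum m (pi / 2 - (- (pi / 2))))"
  proof (rule interval_integral_FTC_integrable[where F = "\<lambda>x. - sine_sum m (pi / 2 - arctan x)"])
    fix x :: real
    show "((\<lambda>x. - sine_sum m (pi / 2 - arctan x)) has_vector_derivative ?f x) (at x)"
      unfolding has_real_derivative_iff_has_vector_derivative[symmetric]
      by (rule derivative_eq_intros DERIV_chain'[OF _ sine_sum_deriv] refl)+
        (simp add: inverse_eq_divide)
    have "continuous_on UNIV ?f"
      by (intro continuous_intros) (auto simp: add_nonneg_eq_0_iff)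
    then show "isCont ?f x" by (simp add: continuous_on_eq_continuous_at)
  next
    show "(((\<lambda>x. - sine_sum m (pi / 2 - arctan x)) \<circ> real_of_ereal) \<longlongrightarrow>
       - sine_sum m (pi / 2 - - (pi / 2))) (at_right (- \<infinity>))"
      using tendsto_minus[OF lim[OF tendsto_arctan_at_bot]] by (simp add: ereal_tendsto_simps)
    show "(((\<lambda>x. - sine_sum m (pi / 2 - arctan x)) \<circ> real_of_ereal) \<longlongrightarrow>
       - sine_sum m (pi / 2 - pi / 2)) (at_left \<infinity>)"
      using tendsto_minus[OF lim[OF tendsto_arctan_at_top]] by (simp add: ereal_tendsto_simps)
  qed (use i in \<open>auto simp: UN set_integrable_def\<close>)
  then show "(\<integral>x. ?f x \<partial>lborel) = 0"
    by (simp add: UN interval_lebesgue_integral_def set_lebesgue_integral_def)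
qed

section \<open>Lebesgue measure in a rotated frame\<close>

definition dirvec :: "real \<Rightarrow> real^2" where
  "dirvec \<phi> = vector [cos \<phi>, sin \<phi>]"

lemma dirvec_inner: "dirvec a \<bullet> dirvec b = cos (a - b)"
  by (simp add: dirvec_def inner_vec_def sum_2 vector_2 cos_diff)

lemma norm_dirvec [simp]: "norm (dirvec a) = 1"
  by (simp add: norm_eq_sqrt_inner dirvec_inner)

lemma area_form_dirvec: "area_form (dirvec a) (dirvec b) = sin (b - a)"
  by (simp add: area_form_alt dirvec_def vector_2 sin_diff)

lemma dirvec_add_pi: "dirvec (a + pi) = - dirvec a"
  by (simp add: dirvec_def vec_eq_iff forall_2 vector_2)

lemma dirvec_basis:
  "x = (x \<bullet> dirvec (a - pi / 2)) *\<^sub>R dirvec (a - pi / 2) + (x \<bullet> dirvec a) *\<^sub>R dirvec a"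
proof -
  have s: "(sin a)\<^sup>2 + (cos a)\<^sup>2 = 1" by simp
  have p: "dirvec (a - pi / 2) = vector [sin a, - cos a]"
    by (simp add: dirvec_def sin_diff cos_diff)
  have "x $ 1 = (x $ 1 * sin a - x $ 2 * cos a) * sin a + (x $ 1 * cos a + x $ 2 * sin a) * cos a"
    "x $ 2 = (x $ 1 * sin a - x $ 2 * cos a) * - cos a + (x $ 1 * cos a + x $ 2 * sin a) * sin a"
    using s by algebra+
  then show ?thesis
    unfolding p by (simp add: dirvec_def vec_eq_iff forall_2 vector_2 inner_vec_def sum_2)
qed

lemma polar_form: obtains \<theta> where "0 \<le> \<theta>" "\<theta> < 2 * pi" "P = norm P *\<^sub>R dirvec \<theta>"
proof (cases "P = 0")
  case True
  then show thesis using that[of 0] by simp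
next
  case False
  have n2: "(norm P)\<^sup>2 = (P $ 1)\<^sup>2 + (P $ 2)\<^sup>2"
    by (simp add: norm_vec_def L2_set_def sum_2)
  have "(P $ 1 / norm P)\<^sup>2 + (P $ 2 / norm P)\<^sup>2 = 1"
    using False by (simp add: power_divide add_divide_distrib[symmetric] n2[symmetric])
  then obtain t where "0 \<le> t" "t < 2 * pi" "P $ 1 / norm P = cos t" "P $ 2 / norm P = sin t"
    using sincos_total_2pi by metis
  moreover from this have "P $ 1 = norm P * cos t" "P $ 2 = norm P * sin t"
    using False by (auto simp: field_simps)
  then have "P = norm P *\<^sub>R dirvec t"
    unfolding vec_eq_iff forall_2 by (simp only: dirvec_def vector_2 vector_scaleR_component real_scaleR_def)
  ultimately show thesis by (intro that)
qed

lemma lborel_invariant_orthogonal: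
  fixes T :: "real^'n::{finite,wellorder} \<Rightarrow> real^'n::_"
  assumes T: "orthogonal_transformation T"
  shows "distr lborel borel T = lborel"
proof (rule lborel_eqI[symmetric])
  have lin: "linear T" using T by (rule orthogonal_transformation_linear)
  then have [measurable]: "T \<in> borel_measurable borel"
    by (intro borel_measurable_continuous_onI linear_continuous_on) (simp add: linear_conv_bounded_linear)
  fix l u :: "(real, 'n) vec" assume le: "\<And>b. b \<in> Basis \<Longrightarrow> l \<bullet> b \<le> u \<bullet> b"
  have iT: "orthogonal_transformation (inv T)" by (rule orthogonal_transformation_inv[OF T])
  have vim: "T -` box l u = inv T ` box l u"
    using orthogonal_transformation_bij[OF T] by (simp add: bij_vimage_eq_inv_image)
  have lm: "box l u \<in> lmeasurable" by (rule lmeasurable_box)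
  have "emeasure (distr lborel borel T) (box l u) = emeasure lborel (T -` box l u)"
    by (subst emeasure_distr) auto
  also have "\<dots> = emeasure lebesgue (T -` box l u)"
    using measurable_sets[of T borel borel "box l u"] by simp
  also have "\<dots> = ennreal (measure lebesgue (inv T ` box l u))"
    unfolding vim by (rule emeasure_eq_measure2[OF measurable_orthogonal_image[OF iT lm]])
  also have "\<dots> = emeasure lebesgue (box l u)"
    unfolding measure_orthogonal_image[OF iT lm] by (rule emeasure_eq_measure2[OF lm, symmetric])
  also have "\<dots> = emeasure lborel (box l u)" by simp
  also have "\<dots> = (\<Prod>b\<in>Basis. (u - l) \<bullet> b)"
    using le by (rule emeasure_lborel_box)
  finally show "emeasure (distr lborel borel T) (box l u) = (\<Prod>b\<in>Basis. (u - l) \<bullet> b)" .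
qed simp

text \<open>Identifies the plane \<open>real^2\<close> with a product of two lines, so that iterated integration over
  the coordinates becomes available.\<close>

lemma lborel_standard_frame:
  "distr (lborel \<Otimes>\<^sub>M lborel) borel (\<lambda>(s, t). s *\<^sub>R axis 1 1 + t *\<^sub>R axis 2 1 :: real^2) = lborel"
  (is "distr _ _ ?g = _")
proof (rule lborel_eqI[symmetric])
  fix l u :: "real^2" assume le: "\<And>b. b \<in> Basis \<Longrightarrow> l \<bullet> b \<le> u \<bullet> b"
  have B: "(Basis :: (real^2) set) = {axis 1 1, axis 2 1}" by (auto simp: Basis_vec_def UNIV_2)
  have le': "l $ 1 \<le> u $ 1" "l $ 2 \<le> u $ 2"
    using le[of "axis 1 1"] le[of "axis 2 1"] by (auto simp: B inner_axis)
  have "?g -` box l u = {l$1<..<u$1} \<times> {l$2<..<u$2}"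
  proof -
    have "axis 1 (1::real) $ (1::2) = 1" "axis 1 (1::real) $ (2::2) = 0"
      "axis 2 (1::real) $ (1::2) = 0" "axis 2 (1::real) $ (2::2) = 1"
      by (simp_all add: axis_def)
    then show ?thesis by (auto simp: box_def B inner_axis)
  qed
  moreover have "?g \<in> measurable (lborel \<Otimes>\<^sub>M lborel) borel" by measurable
  then have "emeasure (distr (lborel \<Otimes>\<^sub>M lborel) borel ?g) (box l u)
     = emeasure (lborel \<Otimes>\<^sub>M lborel) (?g -` box l u \<inter> space (lborel \<Otimes>\<^sub>M lborel))"
    by (rule emeasure_distr) simp
  ultimately have "emeasure (distr (lborel \<Otimes>\<^sub>M lborel) borel ?g) (box l u)
     = emeasure (lborel \<Otimes>\<^sub>M lborel) ({l$1<..<u$1} \<times> {l$2<..<u$2})"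
    by (simp add: space_pair_measure)
  also have "\<dots> = ennreal (u $ 1 - l $ 1) * ennreal (u $ 2 - l $ 2)"
    using le' by (simp add: lborel.emeasure_pair_measure_Times)
  also have "\<dots> = ennreal (\<Prod>b\<in>Basis. (u - l) \<bullet> b)"
  proof -
    have "(\<Prod>b\<in>Basis. (u - l) \<bullet> b) = (u $ 1 - l $ 1) * (u $ 2 - l $ 2)"
      unfolding B by (subst prod.insert) (auto simp: inner_axis axis_eq_axis)
    then show ?thesis using le' by (simp add: ennreal_mult)
  qed
  finally show "emeasure (distr (lborel \<Otimes>\<^sub>M lborel) borel ?g) (box l u)
     = (\<Prod>b\<in>Basis. (u - l) \<bullet> b)" .
qed simp

text \<open>Coordinates adapted to a direction: \<open>t\<close> is the signed distance from the origin of a line with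
  unit normal \<open>dirvec \<phi>\<close>, and \<open>s\<close> is the position on that line.\<close>

lemma lborel_rotated_frame:
  "distr (lborel \<Otimes>\<^sub>M lborel) borel (\<lambda>(s, t). s *\<^sub>R dirvec (\<phi> - pi / 2) + t *\<^sub>R dirvec \<phi>) = lborel"
  (is "distr _ _ ?g = _")
proof -
  define T :: "real^2 \<Rightarrow> real^2" where "T x = (x $ 1) *\<^sub>R dirvec (\<phi> - pi / 2) + (x $ 2) *\<^sub>R dirvec \<phi>" for x
  have "linear T" unfolding T_def by (intro linearI) (auto simp: algebra_simps)
  moreover have "T x \<bullet> T y = x $ 1 * y $ 1 + x $ 2 * y $ 2" for x y
    by (simp add: T_def inner_add_left inner_add_right dirvec_inner)
  ultimately have T: "orthogonal_transformation T"
    by (simp add: orthogonal_transformation_def inner_vec_def sum_2)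
  then have [measurable]: "T \<in> borel_measurable borel"
    by (intro borel_measurable_continuous_onI linear_continuous_on)
      (simp add: orthogonal_transformation_linear linear_conv_bounded_linear[symmetric])
  have "?g = T \<circ> (\<lambda>(s, t). s *\<^sub>R axis 1 1 + t *\<^sub>R axis 2 1)"
    by (auto simp: T_def axis_def)
  then have "distr (lborel \<Otimes>\<^sub>M lborel) borel ?g
      = distr (distr (lborel \<Otimes>\<^sub>M lborel) borel (\<lambda>(s, t). s *\<^sub>R axis 1 1 + t *\<^sub>R axis 2 1)) borel T"
    by (simp add: distr_distr)
  also have "\<dots> = lborel" by (simp only: lborel_standard_frame lborel_invariant_orthogonal[OF T])
  finally show ?thesis .
qed

section \<open>Support lines through an exterior point\<close>

definition support_fn :: "'a::real_inner set \<Rightarrow> 'a \<Rightarrow> real" where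
  "support_fn K n = (SUP x\<in>K. x \<bullet> n)"

lemma support_fn_eqI:
  assumes "x \<in> K" "\<And>y. y \<in> K \<Longrightarrow> y \<bullet> n \<le> x \<bullet> n"
  shows "support_fn K n = x \<bullet> n"
  unfolding support_fn_def by (rule cSup_eq_maximum) (use assms in auto)

lemma support_fn_attained:
  assumes "compact K" "K \<noteq> {}"
  obtains x where "x \<in> K" "x \<bullet> n = support_fn K n"
proof -
  have "continuous_on K (\<lambda>x. x \<bullet> n)" by (intro continuous_intros)
  then obtain x where "x \<in> K" "\<forall>y\<in>K. y \<bullet> n \<le> x \<bullet> n"
    using continuous_attains_sup[OF assms] by blast
  then show thesis using that support_fn_eqI[of x K n] by auto
qed

lemma support_fn_upper:
  assumes "compact K" "x \<in> K"
  shows "x \<bullet> n \<le> support_fn K n"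
  unfolding support_fn_def
proof (rule cSUP_upper)
  have "compact ((\<lambda>x. x \<bullet> n) ` K)"
    by (intro compact_continuous_image continuous_intros assms)
  then show "bdd_above ((\<lambda>x. x \<bullet> n) ` K)"
    by (intro bounded_imp_bdd_above compact_imp_bounded)
qed (use assms in simp)

lemma support_fn_scaleR:
  assumes "compact K" "K \<noteq> {}" "c > 0"
  shows "support_fn K (c *\<^sub>R n) = c * support_fn K n"
proof -
  obtain x where x: "x \<in> K" "x \<bullet> n = support_fn K n" using support_fn_attained assms by blast
  have "support_fn K (c *\<^sub>R n) = x \<bullet> (c *\<^sub>R n)"
    using x support_fn_upper[of K _ n] assms by (intro support_fn_eqI) auto
  then show ?thesis using x by simp
qed

lemma convex_on_support_fn:
  assumes "compact K" "K \<noteq> {}"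
  shows "convex_on UNIV (support_fn K)"
proof (rule convex_onI)
  fix t :: real and u v :: 'a assume t: "0 < t" "t < 1"
  let ?w = "(1 - t) *\<^sub>R u + t *\<^sub>R v"
  obtain x where x: "x \<in> K" "x \<bullet> ?w = support_fn K ?w" using support_fn_attained assms by blast
  have "x \<bullet> ?w = (1 - t) * (x \<bullet> u) + t * (x \<bullet> v)" by (simp add: inner_add_right)
  also have "\<dots> \<le> (1 - t) * support_fn K u + t * support_fn K v"
    using t by (intro add_mono mult_left_mono support_fn_upper assms x) auto
  finally show "support_fn K ?w \<le> (1 - t) * support_fn K u + t * support_fn K v" by (simp add: x)
qed simp

lemma continuous_on_support_fn:
  fixes K :: "'a::euclidean_space set"
  assumes "compact K" "K \<noteq> {}"
  shows "continuous_on UNIV (support_fn K)"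
  by (rule convex_on_continuous[OF open_UNIV convex_on_support_fn[OF assms]])

lemma support_fn_ge_norm:
  fixes K :: "'a::euclidean_space set"
  assumes "compact K" "cball 0 \<epsilon> \<subseteq> K" "\<epsilon> > 0"
  shows "\<epsilon> * norm n \<le> support_fn K n"
proof (cases "n = 0")
  case True
  have "0 \<in> K" using assms by auto
  then show ?thesis using support_fn_upper[OF assms(1), of 0 n] True by simp
next
  case False
  then have "(\<epsilon> / norm n) *\<^sub>R n \<in> K" using assms by auto
  from support_fn_upper[OF assms(1) this, of n] show ?thesis
    using False by (simp add: power2_norm_eq_inner[symmetric] power2_eq_square)
qed

text \<open>Convexity does more than make the sublevel set an interval: because some value lies strictly
  below \<open>r\<close>, the level \<open>r\<close> is attained at the two endpoints only. This is why a point of the plane outside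
  a convex body lies on exactly two support lines.\<close>

lemma convex_coercive_sublevel:
  fixes H :: "real \<Rightarrow> real"
  assumes conv: "convex_on UNIV H" and "\<epsilon> > 0" and coer: "\<And>\<tau>. \<epsilon> * \<bar>\<tau>\<bar> \<le> H \<tau>" and t0: "H \<tau>0 < r"
  obtains a b where "a < \<tau>0" "\<tau>0 < b"
    "\<And>\<tau>. H \<tau> < r \<longleftrightarrow> a < \<tau> \<and> \<tau> < b" "\<And>\<tau>. H \<tau> = r \<longleftrightarrow> \<tau> = a \<or> \<tau> = b"
proof -
  have cont: "continuous_on UNIV H" by (rule convex_on_continuous[OF open_UNIV conv])
  have strict: "H w < r" if "H u < r" "H v \<le> r" "u < w \<and> w < v \<or> v < w \<and> w < u" for u v w
  proof -
    define t where "t = (w - u) / (v - u)"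
    have t: "0 \<le> t" "t < 1" "w = (1 - t) *\<^sub>R u + t *\<^sub>R v"
      using that(3) by (auto simp: t_def divide_simps) (auto simp: algebra_simps)
    have "H w \<le> (1 - t) * H u + t * H v"
      unfolding t(3) using t by (intro convex_onD[OF conv]) auto
    also have "\<dots> < (1 - t) * r + t * r"
      using t that by (intro add_less_le_mono mult_strict_left_mono mult_left_mono) auto
    finally show ?thesis by (simp add: algebra_simps)
  qed
  define N where "N = \<bar>\<tau>0\<bar> + r / \<epsilon>"
  have "0 \<le> \<epsilon> * \<bar>\<tau>0\<bar>" using assms by simp
  then have r: "r > 0" using coer[of \<tau>0] t0 by linarith
  then have N: "\<bar>\<tau>0\<bar> < N" "r \<le> \<epsilon> * \<bar>N\<bar>" using \<open>\<epsilon> > 0\<close> by (auto simp: N_def field_simps)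
  then have HN: "r \<le> H N" "r \<le> H (- N)" using coer[of N] coer[of "- N"] by auto
  have "\<exists>a\<ge>-N. a \<le> \<tau>0 \<and> H a = r"
    using N HN t0 by (intro IVT2' continuous_on_subset[OF cont]) auto
  then obtain a where a: "a \<le> \<tau>0" "H a = r" by blast
  have "\<exists>b\<ge>\<tau>0. b \<le> N \<and> H b = r"
    using N HN t0 by (intro IVT' continuous_on_subset[OF cont]) auto
  then obtain b where b: "\<tau>0 \<le> b" "H b = r" by blast
  have ab: "a < \<tau>0" "\<tau>0 < b" using a b t0 by (auto simp: order.order_iff_strict)
  have ins: "H \<tau> < r" if "a < \<tau>" "\<tau> < b" for \<tau>
    using strict[of \<tau>0 a \<tau>] strict[of \<tau>0 b \<tau>] that a b t0 by (cases \<tau> \<tau>0 rule: linorder_cases) auto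
  have out: "r < H \<tau>" if "\<tau> < a \<or> b < \<tau>" for \<tau>
    using strict[of \<tau>0 \<tau> a] strict[of \<tau>0 \<tau> b] that a b ab t0 by (auto simp: not_le[symmetric])
  show thesis
  proof (rule that[OF ab])
    show "H \<tau> < r \<longleftrightarrow> a < \<tau> \<and> \<tau> < b" "H \<tau> = r \<longleftrightarrow> \<tau> = a \<or> \<tau> = b" for \<tau>
      using ins[of \<tau>] out[of \<tau>] a(2) b(2) by (metis less_irrefl not_less_iff_gr_or_eq)+
  qed
qed

lemma transverse_unit_dirvec:
  assumes "\<rho> > 0"
  shows "transverse_unit (\<rho> *\<^sub>R dirvec \<theta>) = dirvec (\<theta> - pi / 2)"
proof -
  have "\<rho> *\<^sub>R dirvec \<theta> \<noteq> 0" using assms norm_dirvec[of \<theta>] by (metis norm_zero scaleR_eq_0_iff less_irrefl zero_neq_one)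
  from transverse_unit_eq[OF this] show ?thesis
    using assms by (simp add: vec_eq_iff forall_2 vector_2) (simp add: dirvec_def vector_2 sin_diff cos_diff)
qed

text \<open>The orientation of the director is well defined because \<open>K\<close> meets the line on one side of \<open>P\<close>
  only: with points on both sides, \<open>P\<close> itself would lie in \<open>K\<close>.\<close>

lemma director_eqI:
  assumes "convex K" "P \<notin> K" "P - t *\<^sub>R dirvec \<beta> \<in> K" "t > 0"
    and G: "G = {x. dirvec (\<beta> + pi / 2) \<bullet> x = dirvec (\<beta> + pi / 2) \<bullet> P}"
  shows "director K P G = dirvec \<beta>"
proof -
  have G_range: "G = range (\<lambda>t. P + t *\<^sub>R dirvec \<beta>)"
  proof (intro set_eqI iffI)
    fix x assume "x \<in> G"
    then have "(x - P) \<bullet> dirvec (\<beta> + pi / 2) = 0"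
      by (simp add: G inner_diff_left inner_commute)
    then have "x - P = ((x - P) \<bullet> dirvec \<beta>) *\<^sub>R dirvec \<beta>"
      using dirvec_basis[of "x - P" "\<beta> + pi / 2"] by simp
    then have "x = P + ((x - P) \<bullet> dirvec \<beta>) *\<^sub>R dirvec \<beta>" by (simp add: algebra_simps)
    then show "x \<in> range (\<lambda>t. P + t *\<^sub>R dirvec \<beta>)" by blast
  qed (auto simp: G inner_add_right dirvec_inner)
  show ?thesis unfolding director_def
  proof (rule the_equality)
    show "norm (dirvec \<beta>) = 1 \<and> G = range (\<lambda>t. P + t *\<^sub>R dirvec \<beta>) \<and> (\<exists>t>0. P - t *\<^sub>R dirvec \<beta> \<in> K)"
      using assms G_range by auto
  next
    fix v assume v: "norm v = 1 \<and> G = range (\<lambda>t. P + t *\<^sub>R v) \<and> (\<exists>t>0. P - t *\<^sub>R v \<in> K)"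
    then have "P + 1 *\<^sub>R v \<in> G" by blast
    then obtain s where "P + 1 *\<^sub>R v = P + s *\<^sub>R dirvec \<beta>" unfolding G_range by blast
    then have s: "v = s *\<^sub>R dirvec \<beta>" by simp
    from v obtain t' where t': "t' > 0" "P - t' *\<^sub>R v \<in> K" by blast
    have "\<bar>s\<bar> = 1" using v s by simp
    moreover have "s \<noteq> - 1"
    proof
      assume "s = - 1"
      then have *: "P + t' *\<^sub>R dirvec \<beta> \<in> K" using t' s by simp
      have "(t' / (t + t')) *\<^sub>R (P - t *\<^sub>R dirvec \<beta>) + (t / (t + t')) *\<^sub>R (P + t' *\<^sub>R dirvec \<beta>) \<in> K"
        using t' assms * by (intro convexD) (auto simp: add_divide_distrib[symmetric])
      also have "(t' / (t + t')) *\<^sub>R (P - t *\<^sub>R dirvec \<beta>) + (t / (t + t')) *\<^sub>R (P + t' *\<^sub>R dirvec \<beta>)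
         = (t' / (t + t') + t / (t + t')) *\<^sub>R P"
        by (simp add: algebra_simps)
      also have "\<dots> = P" using t' assms by (simp add: add_divide_distrib[symmetric] add.commute)
      finally show False using assms by blast
    qed
    ultimately have "s = 1" by linarith
    then show "v = dirvec \<beta>" by (simp add: s)
  qed
qed

lemma direction_eqI:
  assumes "P = \<rho> *\<^sub>R dirvec \<theta>" "\<rho> > 0" "director K P G = dirvec (\<theta> - pi / 2 + x)"
    and x: "- pi / 2 < x" "x < 3 * pi / 2"
  shows "direction K P G = x"
  unfolding direction_def
proof (rule the_equality)
  have u: "transverse_unit P = dirvec (\<theta> - pi / 2)" using assms by (simp add: transverse_unit_dirvec)
  have "cos (\<theta> - pi / 2 - (\<theta> - pi / 2 + x)) = cos x" by simp
  then have i: "transverse_unit P \<bullet> director K P G = cos x"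
    "area_form (transverse_unit P) (director K P G) = sin x"
    unfolding u assms(3) dirvec_inner area_form_dirvec by simp_all
  show "- pi / 2 < x \<and> x < 3 * pi / 2 \<and> cos x = transverse_unit P \<bullet> director K P G \<and>
        sin x = area_form (transverse_unit P) (director K P G)"
    using x i by simp
  fix a assume a: "- pi / 2 < a \<and> a < 3 * pi / 2 \<and> cos a = transverse_unit P \<bullet> director K P G \<and>
        sin a = area_form (transverse_unit P) (director K P G)"
  then obtain n :: int where n: "a = x + 2 * pi * n" using i sin_cos_eq_iff[of a x] by auto
  have "\<bar>2 * pi * n\<bar> < 2 * pi" using a x n by auto
  then have "\<bar>n\<bar> < 1" by (simp add: abs_mult)
  then show "a = x" using n by simp
qed

text \<open>The arc \<open>(a, b)\<close> consists of the normal directions, measured from that of \<open>P\<close>, of lines that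
  separate \<open>P\<close> from \<open>K\<close>; its endpoints are the normals of the two support lines through \<open>P\<close>.
  A normal \<open>n\<close> of a line through \<open>P\<close> that separates or supports satisfies \<open>n \<bullet> P > 0\<close>, as \<open>0\<close>
  is interior to \<open>K\<close>; so up to a positive factor it is \<open>N \<tau> = e + \<tau> f\<close>, where \<open>e\<close> points
  towards \<open>P\<close> and \<open>f\<close> is \<open>e\<close> turned by a right angle. All these normals have the same product
  \<open>\<rho>\<close> with \<open>P\<close>, and the support function \<open>H \<tau>\<close> of \<open>K\<close> at \<open>N \<tau>\<close> is convex and coercive
  in \<open>\<tau>\<close>. Separation means \<open>H \<tau> < \<rho>\<close> and support means \<open>H \<tau> = \<rho>\<close>. The angles are the
  arctangents of \<open>\<tau>\<close>. The arc need not contain \<open>0\<close>, which is the case of a part of the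
  visual angle that exceeds \<open>\<pi>/2\<close>.\<close>

lemma visible_arc:
  assumes K: "compact K" "convex K" "0 \<in> interior K" and P: "P \<notin> K" "P = \<rho> *\<^sub>R dirvec \<theta>" "\<rho> > 0"
  obtains a b where "- pi / 2 < a" "a < b" "b < pi / 2"
    "\<And>\<psi>. - pi / 2 < \<psi> \<Longrightarrow> \<psi> < pi / 2 \<Longrightarrow>
       support_fn K (dirvec (\<theta> + \<psi>)) < \<rho> * cos \<psi> \<longleftrightarrow> a < \<psi> \<and> \<psi> < b"
    "omega1 K P = pi / 2 - b" "omega2 K P = pi / 2 + a"
proof -
  define e f where "e = dirvec \<theta>" and "f = dirvec (\<theta> + pi / 2)"
  have in_ef: "e \<bullet> e = 1" "f \<bullet> f = 1" "e \<bullet> f = 0" "f \<bullet> e = 0"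
    by (simp_all add: e_def f_def dirvec_inner)
  have Pe: "P \<bullet> e = \<rho>" "P \<bullet> f = 0" by (simp_all add: P(2) e_def[symmetric] in_ef)
  define N where "N \<tau> = e + \<tau> *\<^sub>R f" for \<tau>
  define H where "H \<tau> = support_fn K (N \<tau>)" for \<tau>
  have PN: "P \<bullet> N \<tau> = \<rho>" for \<tau> by (simp add: N_def inner_add_right Pe)
  have "0 \<in> K" using K interior_subset by blast
  then have ne: "K \<noteq> {}" by auto
  obtain \<epsilon> where \<epsilon>: "\<epsilon> > 0" "cball 0 \<epsilon> \<subseteq> K" using K(3) by (auto simp: mem_interior_cball)
  have decomp: "n = (n \<bullet> e) *\<^sub>R N ((n \<bullet> f) / (n \<bullet> e))" if "n \<bullet> e > 0" for n
    using dirvec_basis[of n "\<theta> + pi / 2"] that by (simp add: N_def e_def f_def scaleR_add_right)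
  have dir_N: "dirvec (\<theta> + \<psi>) = cos \<psi> *\<^sub>R N (tan \<psi>)" if "- pi / 2 < \<psi>" "\<psi> < pi / 2" for \<psi>
  proof -
    have i: "dirvec (\<theta> + \<psi>) \<bullet> e = cos \<psi>" "dirvec (\<theta> + \<psi>) \<bullet> f = sin \<psi>"
      by (simp_all add: e_def f_def dirvec_inner cos_diff)
    have "cos \<psi> > 0" using that by (intro cos_gt_zero_pi) auto
    with decomp[of "dirvec (\<theta> + \<psi>)"] show ?thesis by (simp add: i tan_def)
  qed
  have H_dir: "support_fn K (dirvec (\<theta> + \<psi>)) = cos \<psi> * H (tan \<psi>)" if "- pi / 2 < \<psi>" "\<psi> < pi / 2" for \<psi>
    unfolding dir_N[OF that] H_def using that K ne
    by (intro support_fn_scaleR cos_gt_zero_pi) auto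
  have conv: "convex_on UNIV H"
  proof (rule convex_onI)
    fix t x y :: real assume t: "0 < t" "t < 1"
    have "N ((1 - t) *\<^sub>R x + t *\<^sub>R y) = (1 - t) *\<^sub>R N x + t *\<^sub>R N y"
      by (simp add: N_def algebra_simps)
    then show "H ((1 - t) *\<^sub>R x + t *\<^sub>R y) \<le> (1 - t) * H x + t * H y"
      unfolding H_def using convex_onD[OF convex_on_support_fn[OF K(1) ne], of t "N x" "N y"] t by simp
  qed simp
  have coer: "\<epsilon> * \<bar>\<tau>\<bar> \<le> H \<tau>" for \<tau>
  proof -
    have "\<bar>\<tau>\<bar> = \<bar>N \<tau> \<bullet> f\<bar>" by (simp add: N_def inner_add_left in_ef)
    also have "\<dots> \<le> norm (N \<tau>)" using Cauchy_Schwarz_ineq2[of "N \<tau>" f] by (simp add: f_def)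
    finally have "\<epsilon> * \<bar>\<tau>\<bar> \<le> \<epsilon> * norm (N \<tau>)" using \<epsilon> by simp
    also have "\<dots> \<le> H \<tau>" unfolding H_def using \<epsilon> K by (intro support_fn_ge_norm) auto
    finally show ?thesis .
  qed
  obtain \<tau>0 where \<tau>0: "H \<tau>0 < \<rho>"
  proof -
    obtain m c where m: "m \<bullet> P < c" "\<forall>x\<in>K. c < m \<bullet> x"
      using separating_hyperplane_closed_point[of K P] K P compact_imp_closed by blast
    define n where "n = - m"
    have n: "x \<bullet> n < P \<bullet> n" if "x \<in> K" for x
      using m that by (auto simp: n_def inner_commute dest!: bspec[of _ _ x])
    have "P \<bullet> n = \<rho> * (n \<bullet> e)" by (simp add: P(2) e_def inner_commute)
    with n[OF \<open>0 \<in> K\<close>] P(3) have ne0: "n \<bullet> e > 0" by (simp add: zero_less_mult_iff)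
    define \<tau> where "\<tau> = (n \<bullet> f) / (n \<bullet> e)"
    obtain x where x: "x \<in> K" "x \<bullet> N \<tau> = H \<tau>" unfolding H_def using support_fn_attained K ne by blast
    have "n = (n \<bullet> e) *\<^sub>R N \<tau>" using decomp[OF ne0] by (simp add: \<tau>_def)
    then have "x \<bullet> ((n \<bullet> e) *\<^sub>R N \<tau>) < P \<bullet> ((n \<bullet> e) *\<^sub>R N \<tau>)" using n[OF x(1)] by simp
    then have "H \<tau> < \<rho>" using ne0 by (simp add: x PN)
    then show thesis by (rule that)
  qed
  obtain p q where pq: "p < \<tau>0" "\<tau>0 < q" and
    lt: "\<And>\<tau>. H \<tau> < \<rho> \<longleftrightarrow> p < \<tau> \<and> \<tau> < q" and eq: "\<And>\<tau>. H \<tau> = \<rho> \<longleftrightarrow> \<tau> = p \<or> \<tau> = q"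
    by (rule convex_coercive_sublevel[OF conv \<epsilon>(1) coer \<tau>0]) (rule that)
  define a b where "a = arctan p" and "b = arctan q"
  have ab: "- pi / 2 < a" "a < b" "b < pi / 2" "- pi / 2 < b" "a < pi / 2"
    using arctan_bounded[of p] arctan_bounded[of q] pq by (auto simp: a_def b_def arctan_less_iff)
  define L where "L \<psi> = {x. dirvec (\<theta> + \<psi>) \<bullet> x = dirvec (\<theta> + \<psi>) \<bullet> P}" for \<psi>
  have lines: "{G. support_line K G \<and> P \<in> G} = {L a, L b}"
  proof (intro equalityI subsetI)
    fix G assume "G \<in> {G. support_line K G \<and> P \<in> G}"
    then obtain n c where n: "n \<noteq> 0" "G = {x. n \<bullet> x = c}" "K \<subseteq> {x. n \<bullet> x \<le> c}" "G \<inter> K \<noteq> {}" "P \<in> G"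
      unfolding support_line_def by blast
    have c: "c = n \<bullet> P" using n by simp
    have "support_fn K n \<le> c"
    proof -
      obtain x where "x \<in> K" "x \<bullet> n = support_fn K n" using support_fn_attained K ne by blast
      then show ?thesis using n(3) by (auto simp: inner_commute)
    qed
    moreover have "\<epsilon> * norm n > 0" using \<epsilon> n by simp
    ultimately have "c > 0"
      using support_fn_ge_norm[OF K(1) \<epsilon>(2,1), of n] by linarith
    moreover have "c = \<rho> * (n \<bullet> e)" by (simp add: c P(2) e_def)
    ultimately have ne0: "n \<bullet> e > 0" using P(3) by (simp add: zero_less_mult_iff)
    define \<tau> where "\<tau> = (n \<bullet> f) / (n \<bullet> e)"
    have nN: "n = (n \<bullet> e) *\<^sub>R N \<tau>" using decomp[OF ne0] by (simp add: \<tau>_def)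
    have inn: "n \<bullet> x = (n \<bullet> e) * (x \<bullet> N \<tau>)" for x
      by (subst nN) (simp add: inner_commute)
    have c': "c = (n \<bullet> e) * \<rho>" using inn[of P] by (simp add: c PN)
    have on_G: "n \<bullet> x = c \<longleftrightarrow> x \<bullet> N \<tau> = \<rho>" for x
      unfolding inn[of x] c' using ne0 by simp
    obtain y where y: "y \<in> K" "y \<bullet> N \<tau> = \<rho>" using n(2,4) on_G by blast
    have "x \<bullet> N \<tau> \<le> y \<bullet> N \<tau>" if "x \<in> K" for x
    proof -
      have "n \<bullet> x \<le> c" using n(3) that by blast
      then show ?thesis unfolding inn[of x] c' y(2) using ne0 by simp
    qed
    then have "H \<tau> = \<rho>" using support_fn_eqI[OF y(1), of "N \<tau>"] by (simp add: H_def y)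
    then have "\<tau> = p \<or> \<tau> = q" by (simp add: eq)
    moreover have "G = L (arctan \<tau>)"
    proof -
      have "cos (arctan \<tau>) \<noteq> 0" by (rule cos_arctan_not_zero)
      moreover have "dirvec (\<theta> + arctan \<tau>) = cos (arctan \<tau>) *\<^sub>R N \<tau>"
        using dir_N[of "arctan \<tau>"] arctan_bounded[of \<tau>] by (simp add: tan_arctan)
      ultimately show ?thesis
        unfolding L_def n(2) on_G by (simp add: PN inner_commute[of "N \<tau>"])
    qed
    ultimately show "G \<in> {L a, L b}" by (auto simp: a_def b_def)
  next
    have "support_line K (L \<psi>) \<and> P \<in> L \<psi>" if "H (tan \<psi>) = \<rho>" "- pi / 2 < \<psi>" "\<psi> < pi / 2" for \<psi>
    proof -
      let ?n = "dirvec (\<theta> + \<psi>)"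
      have s: "support_fn K ?n = ?n \<bullet> P"
        unfolding H_dir[OF that(2,3)] that(1) unfolding dir_N[OF that(2,3)]
        by (simp add: PN inner_commute[of "N (tan \<psi>)"])
      obtain y where "y \<in> K" "y \<bullet> ?n = support_fn K ?n" using support_fn_attained K ne by blast
      then have "L \<psi> \<inter> K \<noteq> {}" by (auto simp: L_def s inner_commute)
      moreover have "K \<subseteq> {x. ?n \<bullet> x \<le> ?n \<bullet> P}"
        using support_fn_upper[OF K(1), of _ ?n] by (auto simp: s inner_commute)
      moreover have "?n \<noteq> 0" using norm_dirvec[of "\<theta> + \<psi>"] by fastforce
      ultimately show ?thesis unfolding support_line_def L_def by blast
    qed
    moreover have "H (tan a) = \<rho>" "H (tan b) = \<rho>" by (simp_all add: a_def b_def tan_arctan eq)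
    ultimately show "G \<in> {G. support_line K G \<and> P \<in> G}" if "G \<in> {L a, L b}" for G
      using that ab by auto
  qed
  \<comment> \<open>The side of \<open>P\<close> on which a support line touches \<open>K\<close> decides the orientation of its
    director; comparing with the separating normal \<open>N \<tau>0\<close> shows that the two lines differ in it.\<close>
  have contact: "\<exists>y s. y \<in> K \<and> y = P + s *\<^sub>R dirvec (\<theta> + arctan \<tau> - pi / 2) \<and> 0 < s * (\<tau>0 - \<tau>)"
    if H\<tau>: "H \<tau> = \<rho>" for \<tau>
  proof -
    define \<psi> where "\<psi> = arctan \<tau>"
    have \<psi>: "- pi / 2 < \<psi>" "\<psi> < pi / 2" "tan \<psi> = \<tau>"
      using arctan_bounded[of \<tau>] by (auto simp: \<psi>_def tan_arctan)
    then have cos: "cos \<psi> > 0" by (intro cos_gt_zero_pi) auto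
    obtain y where y: "y \<in> K" "y \<bullet> N \<tau> = \<rho>" using H\<tau> support_fn_attained[of K "N \<tau>"] K ne unfolding H_def by metis
    have "y \<bullet> N \<tau>0 < \<rho>" using support_fn_upper[OF K(1) y(1), of "N \<tau>0"] \<tau>0 by (simp add: H_def)
    then have f_side: "0 < (\<tau> - \<tau>0) * (y \<bullet> f)" using y(2) by (simp add: N_def inner_add_right algebra_simps)
    define s where "s = (y - P) \<bullet> dirvec (\<theta> + \<psi> - pi / 2)"
    have "(y - P) \<bullet> dirvec (\<theta> + \<psi>) = 0" by (simp add: dir_N[OF \<psi>(1,2)] \<psi>(3) inner_diff_left y PN)
    then have ys: "y - P = s *\<^sub>R dirvec (\<theta> + \<psi> - pi / 2)"
      using dirvec_basis[of "y - P" "\<theta> + \<psi>"] by (simp add: s_def)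
    have "y \<bullet> f = (y - P) \<bullet> f" by (simp add: inner_diff_left Pe)
    also have "\<dots> = s * cos (\<psi> - pi)" unfolding ys by (simp add: f_def dirvec_inner)
    also have "\<dots> = - (s * cos \<psi>)" by simp
    finally have "0 < (s * (\<tau>0 - \<tau>)) * cos \<psi>" using f_side by (simp add: algebra_simps)
    then have "0 < s * (\<tau>0 - \<tau>)" using cos by (simp add: zero_less_mult_iff)
    moreover have "y = P + s *\<^sub>R dirvec (\<theta> + \<psi> - pi / 2)" using ys by (simp add: algebra_simps)
    ultimately show ?thesis using y(1) unfolding \<psi>_def by blast
  qed
  have dir_b: "direction K P (L b) = b"
  proof -
    obtain y s where y: "y \<in> K" "y = P + s *\<^sub>R dirvec (\<theta> + b - pi / 2)" "0 < s * (\<tau>0 - q)"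
      using contact[of q] eq unfolding b_def by blast
    have "s < 0" using y(3) pq by (simp add: zero_less_mult_iff)
    have "director K P (L b) = dirvec (\<theta> + b - pi / 2)"
      using K P \<open>s < 0\<close> y by (intro director_eqI[of K P "- s"]) (auto simp: L_def)
    then show ?thesis using P ab by (intro direction_eqI[of P \<rho> \<theta>]) (auto simp: algebra_simps)
  qed
  have dir_a: "direction K P (L a) = a + pi"
  proof -
    obtain y s where y: "y \<in> K" "y = P + s *\<^sub>R dirvec (\<theta> + a - pi / 2)" "0 < s * (\<tau>0 - p)"
      using contact[of p] eq unfolding a_def by blast
    have "s > 0" using y(3) pq by (simp add: zero_less_mult_iff)
    have neg: "dirvec (\<theta> + a + pi / 2) = - dirvec (\<theta> + a - pi / 2)"
      "dirvec (\<theta> + a + pi / 2 + pi / 2) = - dirvec (\<theta> + a)"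
      using dirvec_add_pi[of "\<theta> + a - pi / 2"] dirvec_add_pi[of "\<theta> + a"] by (simp_all add: algebra_simps)
    have "P - s *\<^sub>R dirvec (\<theta> + a + pi / 2) \<in> K" using y by (simp add: neg(1))
    moreover have "L a = {x. dirvec (\<theta> + a + pi / 2 + pi / 2) \<bullet> x = dirvec (\<theta> + a + pi / 2 + pi / 2) \<bullet> P}"
      unfolding L_def neg(2) by simp
    ultimately have "director K P (L a) = dirvec (\<theta> + a + pi / 2)"
      using K(2) P(1) \<open>s > 0\<close> by (intro director_eqI[of K P s])
    then show ?thesis using P ab by (intro direction_eqI[of P \<rho> \<theta>]) (auto simp: algebra_simps)
  qed
  have dirs: "support_directions K P = {a + pi, b}"
    unfolding support_directions_def lines by (simp add: dir_a dir_b)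
  have "(THE x. x \<in> support_directions K P \<and> x < pi / 2) = b"
    unfolding dirs using ab by (intro the_equality) auto
  then have o1: "omega1 K P = pi / 2 - b" by (simp add: omega1_def)
  have "(THE x. x \<in> support_directions K P \<and> pi / 2 < x) = a + pi"
    unfolding dirs using ab by (intro the_equality) auto
  then have o2: "omega2 K P = pi / 2 + a" by (simp add: omega2_def)
  have arc: "support_fn K (dirvec (\<theta> + \<psi>)) < \<rho> * cos \<psi> \<longleftrightarrow> a < \<psi> \<and> \<psi> < b"
    if "- pi / 2 < \<psi>" "\<psi> < pi / 2" for \<psi>
  proof -
    have "cos \<psi> > 0" using that by (intro cos_gt_zero_pi) auto
    then have "support_fn K (dirvec (\<theta> + \<psi>)) < \<rho> * cos \<psi> \<longleftrightarrow> H (tan \<psi>) < \<rho>"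
      by (simp add: H_dir[OF that] mult.commute[of \<rho>])
    also have "\<dots> \<longleftrightarrow> arctan p < arctan (tan \<psi>) \<and> arctan (tan \<psi>) < arctan q"
      by (simp only: lt arctan_less_iff)
    also have "arctan (tan \<psi>) = \<psi>" using that by (intro arctan_tan) auto
    finally show ?thesis by (simp add: a_def b_def)
  qed
  show thesis by (rule that[OF ab(1-3) arc o1 o2])
qed

section \<open>The kernel and its integral over the plane\<close>

text \<open>For a line at distance \<open>t\<close> from the origin and the point at position \<open>s\<close> on it, let
  \<open>x = \<pi>/2 - arctan (s/t)\<close> be the angle between the line and the ray from the origin to the
  point. Then \<open>t\<^sup>2/(s\<^sup>2 + t\<^sup>2) = sin\<^sup>2 x\<close>, so the kernel is the derivative of \<open>scaled_Hk m\<close>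
  at \<open>x\<close>, cut off to the strip \<open>0 < t \<le> w\<close>.\<close>

definition strip_kernel :: "nat \<Rightarrow> real \<Rightarrow> real \<Rightarrow> real \<Rightarrow> real" where
  "strip_kernel m w s t =
     (if 0 < t \<and> t \<le> w then t\<^sup>2 / (s\<^sup>2 + t\<^sup>2) * cosine_sum m (pi / 2 - arctan (s / t)) else 0)"

lemma strip_kernel_measurable [measurable]:
  assumes [measurable]: "w \<in> borel_measurable M" "f \<in> borel_measurable M" "g \<in> borel_measurable M"
  shows "(\<lambda>x. strip_kernel m (w x) (f x) (g x)) \<in> borel_measurable M"
  unfolding strip_kernel_def by measurable

lemma strip_kernel_rescale:
  assumes "0 < t" "t \<le> w"
  shows "strip_kernel m w (t * c) t = 1 / (1 + c\<^sup>2) * cosine_sum m (pi / 2 - arctan c)"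
proof -
  have "(t * c)\<^sup>2 + t\<^sup>2 = t\<^sup>2 * (1 + c\<^sup>2)" by (simp add: power_mult_distrib algebra_simps)
  then show ?thesis using assms by (simp add: strip_kernel_def)
qed

lemma integral_strip_kernel_line: "(\<integral>s. strip_kernel m w s t \<partial>lborel) = 0"
proof (cases "0 < t \<and> t \<le> w")
  case True
  have "(\<integral>s. strip_kernel m w s t \<partial>lborel) = \<bar>t\<bar> *\<^sub>R (\<integral>c. strip_kernel m w (0 + t * c) t \<partial>lborel)"
    using True by (intro lborel_integral_real_affine) auto
  also have "\<dots> = 0"
    using True integral_cauchy_cosine_sum[of m] by (simp add: strip_kernel_rescale)
  finally show ?thesis .
qed (auto simp: strip_kernel_def)

lemma nn_integral_strip_kernel_line:
  "(\<integral>\<^sup>+s. ennreal \<bar>strip_kernel m w s t\<bar> \<partial>lborel) \<le> ennreal (4 * (real m)\<^sup>2 * pi * w) * indicator {0..w} t"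
proof (cases "0 < t \<and> t \<le> w")
  case True
  have "(\<integral>\<^sup>+s. ennreal \<bar>strip_kernel m w s t\<bar> \<partial>lborel)
      = ennreal \<bar>t\<bar> * (\<integral>\<^sup>+c. ennreal \<bar>strip_kernel m w (0 + t * c) t\<bar> \<partial>lborel)"
    using True by (intro nn_integral_real_affine) auto
  also have "(\<integral>\<^sup>+c. ennreal \<bar>strip_kernel m w (0 + t * c) t\<bar> \<partial>lborel)
      \<le> (\<integral>\<^sup>+c. ennreal (4 * (real m)\<^sup>2) * ennreal (1 / (1 + c\<^sup>2)) \<partial>lborel)"
  proof (rule nn_integral_mono)
    fix c :: real
    have "\<bar>strip_kernel m w (0 + t * c) t\<bar> = 1 / (1 + c\<^sup>2) * \<bar>cosine_sum m (pi / 2 - arctan c)\<bar>"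
      using True by (simp add: strip_kernel_rescale abs_mult)
    also have "\<dots> \<le> 1 / (1 + c\<^sup>2) * (4 * (real m)\<^sup>2)"
      by (intro mult_left_mono cosine_sum_bound) auto
    finally show "ennreal \<bar>strip_kernel m w (0 + t * c) t\<bar> \<le> ennreal (4 * (real m)\<^sup>2) * ennreal (1 / (1 + c\<^sup>2))"
      by (subst ennreal_mult[symmetric]) (auto simp: mult.commute intro!: ennreal_leI)
  qed
  also have "\<dots> = ennreal (4 * (real m)\<^sup>2 * pi)"
    by (subst nn_integral_cmult) (auto simp: cauchy_density ennreal_mult)
  also have "ennreal \<bar>t\<bar> * ennreal (4 * (real m)\<^sup>2 * pi) \<le> ennreal (4 * (real m)\<^sup>2 * pi * w)"
    using True by (subst ennreal_mult[symmetric], simp, simp)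
      (subst mult.commute, intro ennreal_leI mult_left_mono, auto)
  finally show ?thesis using True by (simp add: mult_left_mono)
qed (auto simp: strip_kernel_def)

text \<open>The kernel at \<open>P\<close> for the line through \<open>P\<close> with unit normal \<open>dirvec \<phi>\<close>. When \<open>h\<close> is the
  support function of \<open>K\<close>, the cutoff keeps exactly the lines that do not separate \<open>P\<close> from
  \<open>K\<close>.\<close>

definition plane_kernel :: "nat \<Rightarrow> (real \<Rightarrow> real) \<Rightarrow> real \<Rightarrow> real^2 \<Rightarrow> real" where
  "plane_kernel m h \<phi> P = strip_kernel m (h \<phi>) (P \<bullet> dirvec (\<phi> - pi / 2)) (P \<bullet> dirvec \<phi>)"

lemma continuous_on_dirvec [continuous_intros]:
  "continuous_on S g \<Longrightarrow> continuous_on S (\<lambda>x. dirvec (g x))" for g :: "'a::t2_space \<Rightarrow> real"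
proof -
  assume g: "continuous_on S g"
  have "dirvec a = cos a *\<^sub>R dirvec 0 + sin a *\<^sub>R dirvec (pi / 2)" for a
    by (simp add: dirvec_def vec_eq_iff forall_2 vector_2)
  then have "(\<lambda>x. dirvec (g x)) = (\<lambda>x. cos (g x) *\<^sub>R dirvec 0 + sin (g x) *\<^sub>R dirvec (pi / 2))" by metis
  then show ?thesis using g by (simp only:) (intro continuous_intros)
qed

lemma measurable_dirvec [measurable]: "dirvec \<in> borel_measurable borel"
  by (intro borel_measurable_continuous_onI continuous_intros)

lemma plane_kernel_measurable [measurable]:
  assumes [measurable]: "h \<in> borel_measurable borel"
  shows "(\<lambda>(\<phi>, P). plane_kernel m h \<phi> P) \<in> borel_measurable (lborel \<Otimes>\<^sub>M lborel)"
    "plane_kernel m h \<phi> \<in> borel_measurable borel"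
  unfolding plane_kernel_def[abs_def] by measurable

lemma plane_kernel_frame:
  "plane_kernel m h \<phi> (s *\<^sub>R dirvec (\<phi> - pi / 2) + t *\<^sub>R dirvec \<phi>) = strip_kernel m (h \<phi>) s t"
  by (simp add: plane_kernel_def inner_add_left dirvec_inner)

lemma nn_integral_plane_kernel:
  assumes [measurable]: "h \<in> borel_measurable borel" and h: "h \<phi> \<le> w"
  shows "(\<integral>\<^sup>+P. ennreal \<bar>plane_kernel m h \<phi> P\<bar> \<partial>lborel) \<le> ennreal (4 * (real m)\<^sup>2 * pi * w\<^sup>2)"
proof (cases "h \<phi> \<ge> 0")
  case True
  have "(\<integral>\<^sup>+P. ennreal \<bar>plane_kernel m h \<phi> P\<bar> \<partial>lborel)
      = (\<integral>\<^sup>+x. ennreal \<bar>strip_kernel m (h \<phi>) (fst x) (snd x)\<bar> \<partial>(lborel \<Otimes>\<^sub>M lborel))"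
    by (subst lborel_rotated_frame[of \<phi>, symmetric], subst nn_integral_distr)
      (auto simp: plane_kernel_frame case_prod_beta')
  also have "\<dots> = (\<integral>\<^sup>+t. (\<integral>\<^sup>+s. ennreal \<bar>strip_kernel m (h \<phi>) s t\<bar> \<partial>lborel) \<partial>lborel)"
    by (subst lborel_pair.nn_integral_snd[symmetric]) auto
  also have "\<dots> \<le> (\<integral>\<^sup>+t. ennreal (4 * (real m)\<^sup>2 * pi * h \<phi>) * indicator {0..h \<phi>} t \<partial>lborel)"
    by (intro nn_integral_mono nn_integral_strip_kernel_line)
  also have "\<dots> = ennreal (4 * (real m)\<^sup>2 * pi * (h \<phi>)\<^sup>2)"
    using True by (simp add: nn_integral_cmult ennreal_mult[symmetric] power2_eq_square mult.assoc)
  also have "\<dots> \<le> ennreal (4 * (real m)\<^sup>2 * pi * w\<^sup>2)"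
    using True h by (intro ennreal_leI mult_left_mono power_mono) auto
  finally show ?thesis .
next
  case False
  then have "plane_kernel m h \<phi> P = 0" for P by (auto simp: plane_kernel_def strip_kernel_def)
  then show ?thesis by simp
qed

text \<open>In the frame of \<open>dirvec \<phi>\<close> the integral vanishes already over each line parallel to the
  strip, whatever its width.\<close>

lemma integral_plane_kernel:
  assumes [measurable]: "h \<in> borel_measurable borel"
  shows "(\<integral>P. plane_kernel m h \<phi> P \<partial>lborel) = 0"
proof -
  let ?f = "\<lambda>(s, t). strip_kernel m (h \<phi>) s t"
  have eq: "integrable lborel (plane_kernel m h \<phi>) \<longleftrightarrow> integrable (lborel \<Otimes>\<^sub>M lborel) ?f"
    by (subst lborel_rotated_frame[of \<phi>, symmetric], subst integrable_distr_eq)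
      (auto simp: plane_kernel_frame case_prod_beta')
  have "(\<integral>\<^sup>+P. ennreal \<bar>plane_kernel m h \<phi> P\<bar> \<partial>lborel) < \<infinity>"
    using nn_integral_plane_kernel[OF assms order_refl] by (rule order.strict_trans1) simp
  then have "integrable lborel (plane_kernel m h \<phi>)" by (intro integrableI_bounded) auto
  then have int: "integrable (lborel \<Otimes>\<^sub>M lborel) ?f" by (simp add: eq)
  have "(\<integral>P. plane_kernel m h \<phi> P \<partial>lborel) = integral\<^sup>L (lborel \<Otimes>\<^sub>M lborel) ?f"
    by (subst lborel_rotated_frame[of \<phi>, symmetric], subst integral_distr)
      (auto simp: plane_kernel_frame case_prod_beta')
  also have "\<dots> = (\<integral>t. (\<integral>s. strip_kernel m (h \<phi>) s t \<partial>lborel) \<partial>lborel)"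
    using lborel_pair.integral_snd[OF int] by simp
  finally show ?thesis by (simp add: integral_strip_kernel_line)
qed

definition angular_integral :: "nat \<Rightarrow> (real \<Rightarrow> real) \<Rightarrow> real^2 \<Rightarrow> real" where
  "angular_integral m h P = (\<integral>\<phi>. indicator {0..<2 * pi} \<phi> * plane_kernel m h \<phi> P \<partial>lborel)"

text \<open>Fubini: for each fixed direction the integral over the plane is zero, and the absolute
  integrals are bounded uniformly in the direction.\<close>

lemma angular_integral_total:
  assumes [measurable]: "h \<in> borel_measurable borel" and h: "\<And>\<phi>. h \<phi> \<le> w"
  shows "integrable lborel (angular_integral m h)" "(\<integral>P. angular_integral m h P \<partial>lborel) = 0"
proof -
  let ?f = "\<lambda>(\<phi>, P). indicator {0..<2 * pi} \<phi> * plane_kernel m h \<phi> P"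
  have "(\<integral>\<^sup>+x. ennreal (norm (?f x)) \<partial>(lborel \<Otimes>\<^sub>M lborel))
      = (\<integral>\<^sup>+\<phi>. (\<integral>\<^sup>+P. indicator {0..<2 * pi} \<phi> * ennreal \<bar>plane_kernel m h \<phi> P\<bar> \<partial>lborel) \<partial>lborel)"
    by (subst lborel.nn_integral_fst[symmetric])
      (auto intro!: nn_integral_cong simp: abs_mult indicator_def)
  also have "\<dots> = (\<integral>\<^sup>+\<phi>. indicator {0..<2 * pi} \<phi> * (\<integral>\<^sup>+P. ennreal \<bar>plane_kernel m h \<phi> P\<bar> \<partial>lborel) \<partial>lborel)"
    by (simp add: nn_integral_cmult)
  also have "\<dots> \<le> (\<integral>\<^sup>+\<phi>. indicator {0..<2 * pi} \<phi> * ennreal (4 * (real m)\<^sup>2 * pi * w\<^sup>2) \<partial>lborel)"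
    by (intro nn_integral_mono mult_left_mono nn_integral_plane_kernel h) auto
  also have "\<dots> = ennreal (2 * pi) * ennreal (4 * (real m)\<^sup>2 * pi * w\<^sup>2)"
    by (simp add: nn_integral_multc)
  also have "\<dots> < \<infinity>" by (simp add: ennreal_mult_less_top)
  finally have int: "integrable (lborel \<Otimes>\<^sub>M lborel) ?f"
    by (intro integrableI_bounded) auto
  show "integrable lborel (angular_integral m h)"
    using lborel_pair.integrable_snd[OF int] by (simp add: angular_integral_def[abs_def])
  have "(\<integral>P. angular_integral m h P \<partial>lborel)
      = (\<integral>\<phi>. (\<integral>P. indicator {0..<2 * pi} \<phi> * plane_kernel m h \<phi> P \<partial>lborel) \<partial>lborel)"
    unfolding angular_integral_def by (rule lborel_pair.Fubini_integral[OF int])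
  then show "(\<integral>P. angular_integral m h P \<partial>lborel) = 0"
    by (simp add: integral_plane_kernel)
qed

lemma integral_periodic_shift:
  fixes g :: "real \<Rightarrow> real"
  assumes [measurable]: "g \<in> borel_measurable borel" and per: "\<And>x. g (x + p) = g x"
    and int: "\<And>a b. integrable lborel (\<lambda>x. indicator {a..<b} x * g x)" and c: "0 \<le> c" "c \<le> p"
  shows "(\<integral>x. indicator {0..<p} x * g x \<partial>lborel) = (\<integral>x. indicator {c..<c + p} x * g x \<partial>lborel)"
proof -
  let ?I = "\<lambda>a b. \<integral>x. indicator {a..<b} x * g x \<partial>lborel"
  have split: "?I a d = ?I a b + ?I b d" if "a \<le> b" "b \<le> d" for a b d
  proof -
    have "?I a d = (\<integral>x. indicator {a..<b} x * g x + indicator {b..<d} x * g x \<partial>lborel)"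
      using that by (intro Bochner_Integration.integral_cong) (auto simp: indicator_def)
    then show ?thesis by (simp add: int)
  qed
  have "?I p (c + p) = \<bar>1\<bar> *\<^sub>R (\<integral>x. indicator {p..<c + p} (p + 1 * x) * g (p + 1 * x) \<partial>lborel)"
    by (rule lborel_integral_real_affine) simp
  also have "\<dots> = ?I 0 c"
    by (simp add: per[of "_", unfolded add.commute[of _ p]])
      (intro Bochner_Integration.integral_cong, auto simp: indicator_def)
  finally show ?thesis using split[of 0 c p] split[of c p "c + p"] c by simp
qed

section \<open>The angular integral at a point\<close>

lemma strip_kernel_bound: "\<bar>strip_kernel m w s t\<bar> \<le> 4 * (real m)\<^sup>2"
proof -
  have "t\<^sup>2 / (s\<^sup>2 + t\<^sup>2) \<le> 1"
    using sum_power2_ge_zero[of s t] by (auto simp: divide_le_eq_1 le_less)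
  then have "\<bar>t\<^sup>2 / (s\<^sup>2 + t\<^sup>2) * cosine_sum m x\<bar> \<le> 1 * (4 * (real m)\<^sup>2)" for x
    unfolding abs_mult by (intro mult_mono cosine_sum_bound) auto
  then show ?thesis by (auto simp: strip_kernel_def)
qed

text \<open>Seen from a point with polar angle \<open>\<theta>\<close>, the kernel at normal direction \<open>\<theta> + \<psi>\<close> is a function
  of \<open>\<psi>\<close> alone, apart from the cutoff.\<close>

lemma plane_kernel_polar:
  assumes "- pi \<le> \<psi>" "\<psi> < pi" "\<rho> > 0"
  shows "plane_kernel m h (\<theta> + \<psi>) (\<rho> *\<^sub>R dirvec \<theta>) =
    (if - (pi / 2) < \<psi> \<and> \<psi> < pi / 2 \<and> \<rho> * cos \<psi> \<le> h (\<theta> + \<psi>)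
     then (cos \<psi>)\<^sup>2 * cosine_sum m (pi / 2 - \<psi>) else 0)"
proof -
  have "cos (\<theta> - (\<theta> + \<psi> - pi / 2)) = sin \<psi>" "cos (\<theta> - (\<theta> + \<psi>)) = cos \<psi>"
    by (simp_all add: cos_diff)
  then have *: "plane_kernel m h (\<theta> + \<psi>) (\<rho> *\<^sub>R dirvec \<theta>) = strip_kernel m (h (\<theta> + \<psi>)) (\<rho> * sin \<psi>) (\<rho> * cos \<psi>)"
    by (simp only: plane_kernel_def inner_scaleR_left dirvec_inner)
  show ?thesis
  proof (cases "- (pi / 2) < \<psi> \<and> \<psi> < pi / 2")
    case True
    then have c: "cos \<psi> > 0" by (intro cos_gt_zero_pi) auto
    have t: "arctan (\<rho> * sin \<psi> / (\<rho> * cos \<psi>)) = \<psi>"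
      using True assms arctan_tan[of \<psi>] by (simp add: tan_def)
    have "(\<rho> * sin \<psi>)\<^sup>2 + (\<rho> * cos \<psi>)\<^sup>2 = \<rho>\<^sup>2"
      by (simp add: power_mult_distrib distrib_left[symmetric])
    then have "(\<rho> * cos \<psi>)\<^sup>2 / ((\<rho> * sin \<psi>)\<^sup>2 + (\<rho> * cos \<psi>)\<^sup>2) = (cos \<psi>)\<^sup>2"
      using assms by (simp add: power_mult_distrib)
    then show ?thesis using True c assms unfolding * strip_kernel_def t by simp
  next
    case False
    have "cos \<psi> \<le> 0"
    proof (cases "\<psi> \<ge> pi / 2")
      case True
      then show ?thesis using assms cos_monotone_0_pi_le[of "pi / 2" \<psi>] by simp
    next
      case F: False
      then show ?thesis using False assms cos_monotone_0_pi_le[of "pi / 2" "- \<psi>"] by simp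
    qed
    then have "\<not> 0 < \<rho> * cos \<psi>" using assms by (simp add: zero_less_mult_iff)
    then show ?thesis using False unfolding * strip_kernel_def by auto
  qed
qed

text \<open>Moves the period of integration so that it is centred at the direction \<open>c + \<pi>\<close>, the polar
  angle of the point to which it is applied; the normals with positive product then form one
  interval \<open>(-\<pi>/2, \<pi>/2)\<close>.\<close>

lemma angular_integral_centered:
  assumes [measurable]: "h \<in> borel_measurable borel" and per: "\<And>\<phi>. h (\<phi> + 2 * pi) = h \<phi>"
    and c: "0 \<le> c" "c \<le> 2 * pi"
  shows "angular_integral m h P =
    (\<integral>\<psi>. indicator {- pi..<pi} \<psi> * plane_kernel m h (c + pi + \<psi>) P \<partial>lborel)"
proof -
  have d: "dirvec (\<phi> + 2 * pi) = dirvec \<phi>" for \<phi> by (simp add: dirvec_def)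
  have "angular_integral m h P = (\<integral>\<phi>. indicator {c..<c + 2 * pi} \<phi> * plane_kernel m h \<phi> P \<partial>lborel)"
    unfolding angular_integral_def
  proof (rule integral_periodic_shift)
    show [measurable]: "(\<lambda>\<phi>. plane_kernel m h \<phi> P) \<in> borel_measurable borel"
      unfolding plane_kernel_def by measurable
    show "plane_kernel m h (\<phi> + 2 * pi) P = plane_kernel m h \<phi> P" for \<phi>
    proof -
      have "\<phi> + 2 * pi - pi / 2 = (\<phi> - pi / 2) + 2 * pi" by simp
      then show ?thesis by (simp only: plane_kernel_def per d)
    qed
    show "integrable lborel (\<lambda>\<phi>. indicator {a..<b} \<phi> * plane_kernel m h \<phi> P)" for a b
    proof (rule Bochner_Integration.integrable_bound)
      show "integrable lborel (\<lambda>\<phi>. indicator {a..b} \<phi> * (4 * (real m)\<^sup>2))"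
        by (intro integrable_mult_left integrable_real_indicator) (auto simp: emeasure_lborel_Icc_eq)
      show "AE \<phi> in lborel. norm (indicator {a..<b} \<phi> * plane_kernel m h \<phi> P)
          \<le> norm (indicator {a..b} \<phi> * (4 * (real m)\<^sup>2))"
        using strip_kernel_bound by (auto simp: indicator_def plane_kernel_def)
    qed measurable
  qed (use c in auto)
  also have "\<dots> = \<bar>1\<bar> *\<^sub>R (\<integral>\<psi>. indicator {c..<c + 2 * pi} (c + pi + 1 * \<psi>) * plane_kernel m h (c + pi + 1 * \<psi>) P \<partial>lborel)"
    by (rule lborel_integral_real_affine) simp
  also have "\<dots> = (\<integral>\<psi>. indicator {- pi..<pi} \<psi> * plane_kernel m h (c + pi + \<psi>) P \<partial>lborel)"
    by simp (intro Bochner_Integration.integral_cong, auto simp: indicator_def)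
  finally show ?thesis .
qed

lemma integral_arc:
  assumes "m \<ge> 1" "a \<le> b"
  shows "integrable lborel (\<lambda>\<psi>. indicator {a..b} \<psi> * ((cos \<psi>)\<^sup>2 * cosine_sum m (pi / 2 - \<psi>)))"
    and "(\<integral>\<psi>. indicator {a..b} \<psi> * ((cos \<psi>)\<^sup>2 * cosine_sum m (pi / 2 - \<psi>)) \<partial>lborel)
       = scaled_Hk m (pi / 2 - a) - scaled_Hk m (pi / 2 - b)"
proof -
  let ?f = "\<lambda>\<psi>. (cos \<psi>)\<^sup>2 * cosine_sum m (pi / 2 - \<psi>)"
  have "has_bochner_integral lborel (\<lambda>\<psi>. ?f \<psi> * indicator {a..b} \<psi>)
      (- scaled_Hk m (pi / 2 - b) - (- scaled_Hk m (pi / 2 - a)))"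
  proof (rule has_bochner_integral_FTC_Icc_real)
    fix \<psi> :: real
    show "((\<lambda>\<psi>. - scaled_Hk m (pi / 2 - \<psi>)) has_real_derivative ?f \<psi>) (at \<psi>)"
      by (rule derivative_eq_intros DERIV_chain'[OF _ scaled_Hk_deriv[OF assms(1)]] refl)+
        (simp add: sin_diff)
    have "continuous_on UNIV ?f" by (intro continuous_intros)
    then show "isCont ?f \<psi>" by (simp add: continuous_on_eq_continuous_at)
  qed fact
  then show "integrable lborel (\<lambda>\<psi>. indicator {a..b} \<psi> * ?f \<psi>)"
    "(\<integral>\<psi>. indicator {a..b} \<psi> * ?f \<psi> \<partial>lborel) = scaled_Hk m (pi / 2 - a) - scaled_Hk m (pi / 2 - b)"
    by (auto simp: has_bochner_integral_iff mult.commute)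
qed

definition angular_support :: "(real^2) set \<Rightarrow> real \<Rightarrow> real" where
  "angular_support K \<phi> = support_fn K (dirvec \<phi>)"

lemma angular_support_periodic: "angular_support K (\<phi> + 2 * pi) = angular_support K \<phi>"
  by (simp add: angular_support_def dirvec_def)

lemma measurable_angular_support:
  assumes "compact K" "K \<noteq> {}"
  shows "angular_support K \<in> borel_measurable borel"
  unfolding angular_support_def[abs_def]
  by (intro borel_measurable_continuous_onI continuous_on_compose2[OF continuous_on_support_fn[OF assms]] continuous_intros) auto

text \<open>No line separates a point of \<open>K\<close> from \<open>K\<close>, so the cutoff is void and the integral runs over
  all of \<open>(-\<pi>/2, \<pi>/2)\<close>.\<close>

lemma angular_integral_inside:
  assumes K: "compact K" "P \<in> K" "P \<noteq> 0" and m: "m \<ge> 1"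
  shows "angular_integral m (angular_support K) P = - pi"
proof -
  obtain c where c: "0 \<le> c" "c < 2 * pi" "- P = norm (- P) *\<^sub>R dirvec c" by (rule polar_form)
  define \<theta> \<rho> where "\<theta> = c + pi" and "\<rho> = norm P"
  have P: "P = \<rho> *\<^sub>R dirvec \<theta>" "\<rho> > 0"
    using c(3) K(3) by (auto simp: \<theta>_def \<rho>_def dirvec_add_pi minus_equation_iff[of P])
  have [measurable]: "angular_support K \<in> borel_measurable borel"
    using K by (intro measurable_angular_support) auto
  have sup: "\<rho> * cos \<psi> \<le> angular_support K (\<theta> + \<psi>)" for \<psi>
    using support_fn_upper[OF K(1,2), of "dirvec (\<theta> + \<psi>)"] unfolding P(1)
    by (simp add: angular_support_def dirvec_inner)
  have "indicator {- pi..<pi} \<psi> * plane_kernel m (angular_support K) (\<theta> + \<psi>) P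
      = indicator {- (pi / 2)..pi / 2} \<psi> * ((cos \<psi>)\<^sup>2 * cosine_sum m (pi / 2 - \<psi>))" for \<psi>
  proof (cases "- (pi / 2) < \<psi> \<and> \<psi> < pi / 2")
    case True
    then have "- pi \<le> \<psi>" "\<psi> < pi" using pi_gt_zero by linarith+
    with True sup show ?thesis
      unfolding P(1) by (subst plane_kernel_polar) (auto simp: indicator_def P(2))
  next
    case False
    have "plane_kernel m (angular_support K) (\<theta> + \<psi>) P = 0" if "- pi \<le> \<psi>" "\<psi> < pi"
      unfolding P(1) plane_kernel_polar[OF that P(2)] using False by auto
    \<comment> \<open>The closed intervals add only the endpoints \<open>\<plusminus>\<pi>/2\<close>, at which the cosine is zero.\<close>
    moreover have "\<psi> = pi / 2 \<or> \<psi> = - (pi / 2) \<or> \<psi> \<notin> {- (pi / 2)..pi / 2}" using False by auto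
    then have "cos \<psi> = 0 \<or> \<psi> \<notin> {- (pi / 2)..pi / 2}" by (metis cos_minus cos_pi_half)
    then have "indicator {- (pi / 2)..pi / 2} \<psi> * ((cos \<psi>)\<^sup>2 * cosine_sum m (pi / 2 - \<psi>)) = 0" by auto
    ultimately show ?thesis by (auto simp: indicator_def)
  qed
  then have "angular_integral m (angular_support K) P
      = (\<integral>\<psi>. indicator {- (pi / 2)..pi / 2} \<psi> * ((cos \<psi>)\<^sup>2 * cosine_sum m (pi / 2 - \<psi>)) \<partial>lborel)"
    using c angular_integral_centered[of "angular_support K" c m P] by (simp add: angular_support_periodic \<theta>_def)
  also have "\<dots> = scaled_Hk m pi - scaled_Hk m 0"
    using integral_arc(2)[OF m, of "- (pi / 2)" "pi / 2"] by simp
  also have "\<dots> = - pi" using scaled_Hk_reflect[OF m, of 0] by (simp add: scaled_Hk_0[OF m])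
  finally show ?thesis .
qed

text \<open>The cutoff removes the arc \<open>(a, b)\<close> of separating normals. The part above \<open>b\<close> integrates to
  the value at \<open>\<omega>\<^sub>1 = \<pi>/2 - b\<close>, the part below \<open>a\<close>, by the reflection formula, to the value at
  \<open>\<omega>\<^sub>2 = \<pi>/2 + a\<close>.\<close>

lemma angular_integral_outside:
  assumes K: "compact K" "convex K" "0 \<in> interior K" "P \<notin> K" and m: "m \<ge> 1"
  shows "angular_integral m (angular_support K) P = scaled_Hk m (omega1 K P) + scaled_Hk m (omega2 K P)"
proof -
  have "0 \<in> K" using K interior_subset by blast
  then have ne: "K \<noteq> {}" "P \<noteq> 0" using K by auto
  obtain c where c: "0 \<le> c" "c < 2 * pi" "- P = norm (- P) *\<^sub>R dirvec c" by (rule polar_form)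
  define \<theta> \<rho> where "\<theta> = c + pi" and "\<rho> = norm P"
  have P: "P = \<rho> *\<^sub>R dirvec \<theta>" "\<rho> > 0"
    using c(3) ne by (auto simp: \<theta>_def \<rho>_def dirvec_add_pi minus_equation_iff[of P])
  have [measurable]: "angular_support K \<in> borel_measurable borel"
    using K ne by (intro measurable_angular_support) auto
  obtain a b where ab: "- pi / 2 < a" "a < b" "b < pi / 2" and
    arc: "\<And>\<psi>. - pi / 2 < \<psi> \<Longrightarrow> \<psi> < pi / 2 \<Longrightarrow>
       support_fn K (dirvec (\<theta> + \<psi>)) < \<rho> * cos \<psi> \<longleftrightarrow> a < \<psi> \<and> \<psi> < b" and
    om: "omega1 K P = pi / 2 - b" "omega2 K P = pi / 2 + a"
    by (rule visible_arc[OF K P]) (rule that)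
  have arc': "\<rho> * cos \<psi> \<le> angular_support K (\<theta> + \<psi>) \<longleftrightarrow> \<psi> \<le> a \<or> b \<le> \<psi>"
    if "- (pi / 2) < \<psi>" "\<psi> < pi / 2" for \<psi>
    using arc[of \<psi>] that by (auto simp: angular_support_def)
  have le: "- (pi / 2) \<le> a" "b \<le> pi / 2" using ab by auto
  let ?D = "\<lambda>\<psi>. (cos \<psi>)\<^sup>2 * cosine_sum m (pi / 2 - \<psi>)"
  have "indicator {- pi..<pi} \<psi> * plane_kernel m (angular_support K) (\<theta> + \<psi>) P
      = indicator {- (pi / 2)..a} \<psi> * ?D \<psi> + indicator {b..pi / 2} \<psi> * ?D \<psi>" for \<psi>
  proof (cases "- (pi / 2) < \<psi> \<and> \<psi> < pi / 2")
    case True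
    then have "- pi \<le> \<psi>" "\<psi> < pi" using pi_gt_zero by linarith+
    then show ?thesis
      unfolding P(1) using True P(2) arc'[of \<psi>] ab by (auto simp: indicator_def plane_kernel_polar)
  next
    case False
    have "plane_kernel m (angular_support K) (\<theta> + \<psi>) P = 0" if "- pi \<le> \<psi>" "\<psi> < pi"
      unfolding P(1) plane_kernel_polar[OF that P(2)] using False by auto
    \<comment> \<open>The closed intervals add only the endpoints \<open>\<plusminus>\<pi>/2\<close>, at which the cosine is zero.\<close>
    moreover have "\<psi> = pi / 2 \<or> \<psi> = - (pi / 2) \<or> \<psi> \<notin> {- (pi / 2)..pi / 2}" using False by auto
    then have "cos \<psi> = 0 \<or> \<psi> \<notin> {- (pi / 2)..pi / 2}" by (metis cos_minus cos_pi_half)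
    then have "indicator {- (pi / 2)..a} \<psi> * ?D \<psi> = 0" "indicator {b..pi / 2} \<psi> * ?D \<psi> = 0"
      using ab by (auto simp: indicator_def)
    ultimately show ?thesis by (auto simp: indicator_def)
  qed
  then have "angular_integral m (angular_support K) P
      = (\<integral>\<psi>. indicator {- (pi / 2)..a} \<psi> * ?D \<psi> + indicator {b..pi / 2} \<psi> * ?D \<psi> \<partial>lborel)"
    using c angular_integral_centered[of "angular_support K" c m P] by (simp add: angular_support_periodic \<theta>_def)
  also have "\<dots> = (scaled_Hk m (pi / 2 - - (pi / 2)) - scaled_Hk m (pi / 2 - a))
      + (scaled_Hk m (pi / 2 - b) - scaled_Hk m (pi / 2 - pi / 2))"
    by (simp only: Bochner_Integration.integral_add integral_arc[OF m le(1)] integral_arc[OF m le(2)])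
  also have "\<dots> = scaled_Hk m (pi / 2 - b) + scaled_Hk m (pi / 2 + a)"
    using scaled_Hk_reflect[OF m, of 0] scaled_Hk_reflect[OF m, of "pi / 2 + a"]
    by (simp add: scaled_Hk_0[OF m])
  finally show ?thesis by (simp add: om)
qed


section \<open>The integral formula\<close>

theorem proposition9:
  fixes K :: "(real^2) set" and k :: int
  assumes "compact K" and "convex K" and "C2_curve (frontier K)" and "0 \<in> interior K"
    and "odd k" and "k \<ge> 3"
  shows "set_integrable lborel (- K) (\<lambda>P. Hk k (omega1 K P) + Hk k (omega2 K P)) \<and>
         ((real_of_int k)\<^sup>2 - 1) *
           (LINT P:- K|lborel. Hk k (omega1 K P) + Hk k (omega2 K P)) =
         pi * measure lborel K"
proof -
  define m where "m = nat (k div 2)"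
  have k: "k = 2 * int m + 1" and m: "m \<ge> 1" using assms by (auto simp: m_def elim!: oddE)
  define C where "C = (real_of_int k)\<^sup>2 - 1"
  have "(real_of_int k)\<^sup>2 \<ge> 3\<^sup>2" using assms by (intro power_mono) auto
  then have C: "C > 0" by (simp add: C_def)
  define \<Phi> where "\<Phi> = angular_integral m (angular_support K)"
  define f where "f P = Hk k (omega1 K P) + Hk k (omega2 K P)" for P
  have "0 \<in> K" using assms interior_subset by blast
  then have ne: "K \<noteq> {}" by auto
  obtain R where R: "\<And>x. x \<in> K \<Longrightarrow> norm x \<le> R"
    using compact_imp_bounded[OF assms(1)] by (auto simp: bounded_iff)
  have R: "angular_support K \<phi> \<le> R" for \<phi>
  proof -
    obtain x where "x \<in> K" "x \<bullet> dirvec \<phi> = angular_support K \<phi>"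
      unfolding angular_support_def using support_fn_attained assms(1) ne by blast
    then show ?thesis using R[of x] norm_cauchy_schwarz[of x "dirvec \<phi>"] by simp
  qed
  have \<Phi>: "integrable lborel \<Phi>" "(\<integral>P. \<Phi> P \<partial>lborel) = 0"
    unfolding \<Phi>_def using angular_integral_total[OF measurable_angular_support[OF assms(1) ne] R] by auto
  have K[measurable]: "K \<in> sets borel" using assms(1) by (intro borel_compact)
  have out: "indicator (- K) P * \<Phi> P = C * (indicator (- K) P * f P)" for P
    using angular_integral_outside[OF assms(1,2,4), of P m] m
    by (cases "P \<in> K") (simp_all add: \<Phi>_def f_def C_def scaled_Hk_def k distrib_left)
  have \<Phi>_out: "integrable lborel (\<lambda>P. indicator (- K) P * \<Phi> P)"
    and \<Phi>_in: "integrable lborel (\<lambda>P. indicator K P * \<Phi> P)"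
    using integrable_real_mult_indicator[OF _ \<Phi>(1)] K by (simp_all add: mult.commute)
  have int: "integrable lborel (\<lambda>P. indicator (- K) P * f P)"
    using \<Phi>_out C unfolding out by simp
  \<comment> \<open>\<open>\<Phi>\<close> has integral zero over the plane and equals \<open>-\<pi>\<close> almost everywhere on \<open>K\<close>.\<close>
  have "C * (\<integral>P. indicator (- K) P * f P \<partial>lborel) = (\<integral>P. indicator (- K) P * \<Phi> P \<partial>lborel)"
    unfolding out by simp
  also have "\<dots> = (\<integral>P. \<Phi> P - indicator K P * \<Phi> P \<partial>lborel)"
    by (intro Bochner_Integration.integral_cong) (auto simp: indicator_def)
  also have "\<dots> = - (\<integral>P. indicator K P * \<Phi> P \<partial>lborel)"
    using \<Phi> \<Phi>_in by simp
  also have "(\<integral>P. indicator K P * \<Phi> P \<partial>lborel) = (\<integral>P. indicator K P * - pi \<partial>lborel)"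
  proof (rule integral_cong_AE)
    have "AE P in lborel. P \<noteq> (0 :: real^2)" by (rule AE_lborel_singleton)
    then show "AE P in lborel. indicator K P * \<Phi> P = indicator K P * - pi"
      by eventually_elim (use angular_integral_inside[OF assms(1) _ _ m] in \<open>auto simp: indicator_def \<Phi>_def\<close>)
  qed (use borel_measurable_integrable[OF \<Phi>_in] in auto)
  also have "\<dots> = - pi * measure lborel K" by simp
  finally have "C * (\<integral>P. indicator (- K) P * f P \<partial>lborel) = pi * measure lborel K" by simp
  then show ?thesis
    using int by (simp add: set_integrable_def set_lebesgue_integral_def f_def C_def)
qed

end
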